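(* Let $(M,d)$ be a (nonempty) compact and perfect metric space, let $X=M^{\mathbb{Z}}$ be endowed with the metric $$r(x,y)=\sum_{n\in\mathbb{Z}}\min\left\{\frac{1}{a_{|n|}+1},\,d(x_n,y_n)\right\},$$ where $(a_n)_{n\ge 0}$ is any monotone increasing sequence of nonnegative real numbers such that $\sum_{k\ge 0}\frac{1}{a_k+1}<\infty$ and, for each $\alpha>0$, $\lim_{k\to\infty}\frac{a_k}{e^{\alpha k}}=0$. Let $T:X\to X$ be the full-shift, $(Tx)_i=x_{i-1}$ for $i\in\mathbb{Z}$. Then $$HP=\{\mu\in\mathcal{M}_e\mid \dim_H^+(\mu)=0 \ \text{ and }\ \dim_P^-(\mu)=\infty\}$$ is a residual subset of $\mathcal{M}(T)$, where $\mathcal{M}_e\subset\mathcal{M}(T)$ is the set of ergodic measures.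
   Context: A metric space is perfect if it has no isolated points. $\mathcal{M}(T)$ is the space of $T$-invariant Borel probability measures on $X$, endowed with the weak topology ($\mu_\alpha\to\mu$ iff $\int f\,d\mu_\alpha\to\int f\,d\mu$ for every bounded continuous $f:X\to\mathbb{R}$). A subset of a topological space is residual if it contains a countable intersection of open dense sets. For a Borel probability measure $\mu$ on $X$, $\dim_H^+(\mu)=\inf\{\dim_H(E)\mid E\subset X\text{ Borel},\ \mu(X\setminus E)=0\}$ and $\dim_P^-(\mu)=\inf\{\dim_P(E)\mid E\subset X\text{ Borel},\ \mu(E)>0\}$. Here $\dim_H(E)$ is the Hausdorff dimension, and $\dim_P(E)=\inf\{\alpha>0\mid P^\alpha(E)=0\}$ is the packing dimension ($\inf\emptyset=+\infty$), where $P^\alpha$ is the $\alpha$-packing measure: $P^\alpha(E)=\inf\{\sum_{i} P_0^\alpha(E_i)\mid E\subset\bigcup_{i\in\mathbb{N}}E_i\}$, with $P_0^\alpha(E)=\lim_{\delta\downarrow 0}\sup\{\sum_k(2\varepsilon_k)^\alpha\}$, the supremum being over all countable families of pairwise disjoint closed balls $\overline{B}(x_k,\varepsilon_k)$ with $x_k\in E$ and $\varepsilon_k\le\delta$. *)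

theory Defs
  imports "HOL-Probability.Probability"
begin

section \<open>Hausdorff and packing dimension with respect to a metric\<close>

text \<open>
  A metric is passed as a function \<open>d\<close> on a whole type, so that the space is
  \<open>(UNIV, d)\<close> in the sense of the library locale \<^locale>\<open>Metric_space\<close>.
\<close>

definition mdiam :: "('b \<Rightarrow> 'b \<Rightarrow> real) \<Rightarrow> 'b set \<Rightarrow> ennreal" where
  "mdiam d A = (SUP x\<in>A. SUP y\<in>A. ennreal (d x y))"

text \<open>
  Finite covers are included because sets of the cover may be empty: \<open>mdiam d {} = 0\<close> and
  \<open>0 powr \<alpha> = 0\<close>. The diameters are at most \<open>\<delta>\<close>, hence finite, so \<open>enn2real\<close> loses nothing.
\<close>

definition hausdorff_pre :: "('b \<Rightarrow> 'b \<Rightarrow> real) \<Rightarrow> real \<Rightarrow> real \<Rightarrow> 'b set \<Rightarrow> ennreal" where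
  "hausdorff_pre d \<alpha> \<delta> E =
     (INF U\<in>{U :: nat \<Rightarrow> 'b set. E \<subseteq> (\<Union>k. U k) \<and> (\<forall>k. mdiam d (U k) \<le> ennreal \<delta>)}.
        \<Sum>k. ennreal (enn2real (mdiam d (U k)) powr \<alpha>))"

definition hausdorff_measure :: "('b \<Rightarrow> 'b \<Rightarrow> real) \<Rightarrow> real \<Rightarrow> 'b set \<Rightarrow> ennreal" where
  "hausdorff_measure d \<alpha> E = Lim (at_right 0) (\<lambda>\<delta>. hausdorff_pre d \<alpha> \<delta> E)"

definition hausdorff_dim :: "('b \<Rightarrow> 'b \<Rightarrow> real) \<Rightarrow> 'b set \<Rightarrow> ennreal" where
  "hausdorff_dim d E = Inf {ennreal \<alpha> | \<alpha>. 0 < \<alpha> \<and> hausdorff_measure d \<alpha> E = 0}"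

text \<open>
  \<open>(I, x, e)\<close> is a countable (finite or infinite) family of pairwise disjoint closed balls
  with centres in \<open>E\<close> and radii at most \<open>\<delta>\<close>.
\<close>

definition packings ::
  "('b \<Rightarrow> 'b \<Rightarrow> real) \<Rightarrow> real \<Rightarrow> 'b set \<Rightarrow> (nat set \<times> (nat \<Rightarrow> 'b) \<times> (nat \<Rightarrow> real)) set" where
  "packings d \<delta> E = {(I, x, e).
     (\<forall>k\<in>I. x k \<in> E \<and> 0 < e k \<and> e k \<le> \<delta>) \<and>
     disjoint_family_on (\<lambda>k. Metric_space.mcball UNIV d (x k) (e k)) I}"

definition packing_pre\<delta> :: "('b \<Rightarrow> 'b \<Rightarrow> real) \<Rightarrow> real \<Rightarrow> real \<Rightarrow> 'b set \<Rightarrow> ennreal" where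
  "packing_pre\<delta> d \<alpha> \<delta> E =
     (SUP (I, x, e)\<in>packings d \<delta> E. \<Sum>\<^sub>\<infinity>k\<in>I. ennreal ((2 * e k) powr \<alpha>))"

definition packing_pre :: "('b \<Rightarrow> 'b \<Rightarrow> real) \<Rightarrow> real \<Rightarrow> 'b set \<Rightarrow> ennreal" where
  "packing_pre d \<alpha> E = Lim (at_right 0) (\<lambda>\<delta>. packing_pre\<delta> d \<alpha> \<delta> E)"

definition packing_measure :: "('b \<Rightarrow> 'b \<Rightarrow> real) \<Rightarrow> real \<Rightarrow> 'b set \<Rightarrow> ennreal" where
  "packing_measure d \<alpha> E =
     (INF F\<in>{F :: nat \<Rightarrow> 'b set. E \<subseteq> (\<Union>i. F i)}. \<Sum>i. packing_pre d \<alpha> (F i))"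

definition packing_dim :: "('b \<Rightarrow> 'b \<Rightarrow> real) \<Rightarrow> 'b set \<Rightarrow> ennreal" where
  "packing_dim d E = Inf {ennreal \<alpha> | \<alpha>. 0 < \<alpha> \<and> packing_measure d \<alpha> E = 0}"

text \<open>Both limits exist, by monotonicity in \<open>\<delta>\<close>, so that \<^const>\<open>Lim\<close> is meaningful.\<close>

lemma Lim_at_right_0_mono:
  fixes f :: "real \<Rightarrow> ennreal"
  assumes "\<And>s t. 0 < s \<Longrightarrow> s \<le> t \<Longrightarrow> f s \<le> f t"
  shows "Lim (at_right 0) f = (INF t\<in>{0<..}. f t)"
proof (rule tendsto_Lim)
  show "(f \<longlongrightarrow> (INF t\<in>{0<..}. f t)) (at_right 0)"
  proof (rule order_tendstoI)
    fix a assume "a < (INF t\<in>{0<..}. f t)"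
    then have "\<And>t. 0 < t \<Longrightarrow> a < f t"
      by (meson INF_lower greaterThan_iff less_le_trans)
    then show "\<forall>\<^sub>F x in at_right 0. a < f x"
      by (auto simp: eventually_at_right_field intro: exI[of _ 1])
  next
    fix a assume "(INF t\<in>{0<..}. f t) < a"
    then obtain t where "0 < t" "f t < a"
      by (auto simp: INF_less_iff)
    moreover have "f s < a" if "0 < s" "s < t" for s
      using assms[of s t] that \<open>f t < a\<close> by auto
    ultimately show "\<forall>\<^sub>F x in at_right 0. f x < a"
      unfolding eventually_at_right_field by blast
  qed
qed simp

lemma Lim_at_right_0_antimono:
  fixes f :: "real \<Rightarrow> ennreal"
  assumes "\<And>s t. 0 < s \<Longrightarrow> s \<le> t \<Longrightarrow> f t \<le> f s"
  shows "Lim (at_right 0) f = (SUP t\<in>{0<..}. f t)"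
proof (rule tendsto_Lim)
  show "(f \<longlongrightarrow> (SUP t\<in>{0<..}. f t)) (at_right 0)"
  proof (rule order_tendstoI)
    fix a assume "(SUP t\<in>{0<..}. f t) < a"
    then have "\<And>t. 0 < t \<Longrightarrow> f t < a"
      by (meson SUP_upper greaterThan_iff le_less_trans)
    then show "\<forall>\<^sub>F x in at_right 0. f x < a"
      by (auto simp: eventually_at_right_field intro: exI[of _ 1])
  next
    fix a assume "a < (SUP t\<in>{0<..}. f t)"
    then obtain t where "0 < t" "a < f t"
      by (auto simp: less_SUP_iff)
    moreover have "a < f s" if "0 < s" "s < t" for s
      using assms[of s t] that \<open>a < f t\<close> by auto
    ultimately show "\<forall>\<^sub>F x in at_right 0. a < f x"
      unfolding eventually_at_right_field by blast
  qed
qed simp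

lemma hausdorff_measure_eq_SUP:
  "hausdorff_measure d \<alpha> E = (SUP \<delta>\<in>{0<..}. hausdorff_pre d \<alpha> \<delta> E)"
  unfolding hausdorff_measure_def hausdorff_pre_def
  by (intro Lim_at_right_0_antimono INF_superset_mono)
     (auto intro: order_trans ennreal_leI)

lemma packing_pre_eq_INF:
  "packing_pre d \<alpha> E = (INF \<delta>\<in>{0<..}. packing_pre\<delta> d \<alpha> \<delta> E)"
  unfolding packing_pre_def packing_pre\<delta>_def
  by (intro Lim_at_right_0_mono SUP_subset_mono) (force simp: packings_def)+


section \<open>Invariant and ergodic measures, weak topology\<close>

definition borel_metric :: "('b \<Rightarrow> 'b \<Rightarrow> real) \<Rightarrow> 'b measure" where
  "borel_metric d = sigma UNIV {U. openin (Metric_space.mtopology UNIV d) U}"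

definition invariant_measures :: "('b \<Rightarrow> 'b \<Rightarrow> real) \<Rightarrow> ('b \<Rightarrow> 'b) \<Rightarrow> 'b measure set" where
  "invariant_measures d T = {\<mu>. prob_space \<mu> \<and> sets \<mu> = sets (borel_metric d) \<and>
     (\<forall>A\<in>sets \<mu>. emeasure \<mu> (T -` A) = emeasure \<mu> A)}"

definition ergodic_measures :: "('b \<Rightarrow> 'b \<Rightarrow> real) \<Rightarrow> ('b \<Rightarrow> 'b) \<Rightarrow> 'b measure set" where
  "ergodic_measures d T = {\<mu> \<in> invariant_measures d T.
     \<forall>A\<in>sets \<mu>. T -` A = A \<longrightarrow> emeasure \<mu> A = 0 \<or> emeasure \<mu> A = 1}"

definition bounded_continuous :: "('b \<Rightarrow> 'b \<Rightarrow> real) \<Rightarrow> ('b \<Rightarrow> real) set" where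
  "bounded_continuous d =
     {f. continuous_map (Metric_space.mtopology UNIV d) euclideanreal f \<and> bounded (range f)}"

text \<open>
  The weak topology is the initial topology of the maps \<open>\<mu> \<mapsto> \<integral>x. f x \<partial>\<mu>\<close>, \<open>f\<close> bounded continuous;
  its convergence is characterised in \<open>limitin_weak_topology\<close> below.
\<close>

definition weak_topology :: "('b \<Rightarrow> 'b \<Rightarrow> real) \<Rightarrow> ('b \<Rightarrow> 'b) \<Rightarrow> 'b measure topology" where
  "weak_topology d T = pullback_topology (invariant_measures d T)
     (\<lambda>\<mu>. \<lambda>f\<in>bounded_continuous d. \<integral>x. f x \<partial>\<mu>)
     (product_topology (\<lambda>_. euclideanreal) (bounded_continuous d))"

lemma topspace_weak_topology [simp]: "topspace (weak_topology d T) = invariant_measures d T"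
  by (auto simp: weak_topology_def topspace_pullback_topology)

lemma limitin_pullback_topology:
  assumes "A \<subseteq> f -` topspace X"
  shows "limitin (pullback_topology A f X) g l F \<longleftrightarrow>
    l \<in> A \<and> (\<forall>\<^sub>F c in F. g c \<in> A) \<and> limitin X (\<lambda>c. f (g c)) (f l) F"
    (is "?L \<longleftrightarrow> ?R")
proof
  assume L: ?L
  have top: "topspace (pullback_topology A f X) = A"
    using assms by (auto simp: topspace_pullback_topology)
  have "l \<in> A"
    using L limitin_topspace top by metis
  moreover have "\<forall>\<^sub>F c in F. g c \<in> A"
    using L calculation openin_topspace[of "pullback_topology A f X"] 
    unfolding limitin_def top by blast
  moreover have "\<forall>\<^sub>F c in F. f (g c) \<in> U" if "openin X U" "f l \<in> U" for U
  proof -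
    have "openin (pullback_topology A f X) (f -` U \<inter> A)"
      using that by (auto simp: openin_pullback_topology)
    then have "\<forall>\<^sub>F c in F. g c \<in> f -` U \<inter> A"
      using L that \<open>l \<in> A\<close> by (auto simp: limitin_def)
    then show ?thesis
      by (rule eventually_mono) auto
  qed
  ultimately show ?R
    using assms by (auto simp: limitin_def)
next
  assume R: ?R
  show ?L
    unfolding limitin_def
  proof (intro conjI allI impI)
    show "l \<in> topspace (pullback_topology A f X)"
      using R assms by (auto simp: topspace_pullback_topology)
    fix U assume U: "openin (pullback_topology A f X) U \<and> l \<in> U"
    then obtain V where V: "openin X V" "U = f -` V \<inter> A"
      by (auto simp: openin_pullback_topology)
    then have "\<forall>\<^sub>F c in F. f (g c) \<in> V" "\<forall>\<^sub>F c in F. g c \<in> A"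
      using R U by (auto simp: limitin_def)
    then have "\<forall>\<^sub>F c in F. f (g c) \<in> V \<and> g c \<in> A"
      by (rule eventually_conj)
    then show "\<forall>\<^sub>F c in F. g c \<in> U"
      by (rule eventually_mono) (use V in auto)
  qed
qed

lemma limitin_weak_topology:
  "limitin (weak_topology d T) \<nu> \<mu> F \<longleftrightarrow>
     \<mu> \<in> invariant_measures d T \<and> (\<forall>\<^sub>F c in F. \<nu> c \<in> invariant_measures d T) \<and>
     (\<forall>f\<in>bounded_continuous d. ((\<lambda>c. \<integral>x. f x \<partial>\<nu> c) \<longlongrightarrow> (\<integral>x. f x \<partial>\<mu>)) F)"
  unfolding weak_topology_def
  by (subst limitin_pullback_topology) (auto simp: limitin_componentwise)

definition residual_in :: "'c topology \<Rightarrow> 'c set \<Rightarrow> bool" where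
  "residual_in X S \<longleftrightarrow> S \<subseteq> topspace X \<and>
     (\<exists>\<G>. countable \<G> \<and> (\<forall>U\<in>\<G>. openin X U \<and> X closure_of U = topspace X) \<and>
          topspace X \<inter> \<Inter>\<G> \<subseteq> S)"

definition upper_hausdorff_dim :: "('b \<Rightarrow> 'b \<Rightarrow> real) \<Rightarrow> 'b measure \<Rightarrow> ennreal" where
  "upper_hausdorff_dim d \<mu> =
     Inf {hausdorff_dim d E | E. E \<in> sets (borel_metric d) \<and> emeasure \<mu> (UNIV - E) = 0}"

definition lower_packing_dim :: "('b \<Rightarrow> 'b \<Rightarrow> real) \<Rightarrow> 'b measure \<Rightarrow> ennreal" where
  "lower_packing_dim d \<mu> =
     Inf {packing_dim d E | E. E \<in> sets (borel_metric d) \<and> emeasure \<mu> E > 0}"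


section \<open>The full shift\<close>

definition shift_dist ::
  "(nat \<Rightarrow> real) \<Rightarrow> (int \<Rightarrow> 'a::metric_space) \<Rightarrow> (int \<Rightarrow> 'a) \<Rightarrow> real" where
  "shift_dist a x y = (\<Sum>\<^sub>\<infinity>n\<in>UNIV. min (1 / (a (nat \<bar>n\<bar>) + 1)) (dist (x n) (y n)))"

definition full_shift :: "(int \<Rightarrow> 'a) \<Rightarrow> (int \<Rightarrow> 'a)" where
  "full_shift x = (\<lambda>i. x (i - 1))"

lemma summable_on_shift_dist:
  fixes x y :: "int \<Rightarrow> 'a::metric_space"
  assumes nonneg: "\<And>n. 0 \<le> a n" and summ: "summable (\<lambda>n. 1 / (a n + 1))"
  shows "(\<lambda>n. min (1 / (a (nat \<bar>n\<bar>) + 1)) (dist (x n) (y n))) summable_on UNIV"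
proof -
  let ?g = "\<lambda>n::int. 1 / (a (nat \<bar>n\<bar>) + 1)"
  have *: "(\<lambda>n. 1 / (a n + 1)) summable_on UNIV"
    using nonneg summ by (intro summable_nonneg_imp_summable_on) (auto simp: add_nonneg_nonneg)
  have "?g summable_on range int"
    by (subst summable_on_reindex) (use * in \<open>auto simp: o_def inj_on_def\<close>)
  moreover have "?g summable_on range (\<lambda>n. - int n)"
    by (subst summable_on_reindex) (use * in \<open>auto simp: o_def inj_on_def\<close>)
  ultimately have "?g summable_on (range int \<union> range (\<lambda>n. - int n))"
    by (rule summable_on_union)
  moreover have "range int \<union> range (\<lambda>n. - int n) = UNIV"
    by (auto simp: image_iff) (metis int_cases2)
  ultimately have "?g summable_on UNIV"
    by simp
  then show ?thesis
    by (rule summable_on_comparison_test) (use nonneg in \<open>auto simp: add_nonneg_nonneg\<close>)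
qed

lemma Metric_space_shift_dist:
  fixes a :: "nat \<Rightarrow> real"
  assumes nonneg: "\<And>n. 0 \<le> a n" and summ: "summable (\<lambda>n. 1 / (a n + 1))"
  shows "Metric_space (UNIV :: (int \<Rightarrow> 'a::metric_space) set) (shift_dist a)"
proof
  have s: "(\<lambda>n. min (1 / (a (nat \<bar>n\<bar>) + 1)) (dist (x n) (y n))) summable_on UNIV"
    for x y :: "int \<Rightarrow> 'a"
    by (rule summable_on_shift_dist[OF assms])
  have p: "0 < 1 / (a n + 1)" for n
    using nonneg[of n] by simp
  have t: "0 \<le> min (1 / (a (nat \<bar>n\<bar>) + 1)) (dist (x n) (y n))"
    for n and x y :: "int \<Rightarrow> 'a"
    using p[of "nat \<bar>n\<bar>"] by (simp add: less_imp_le)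
  fix x y z :: "int \<Rightarrow> 'a"
  show "0 \<le> shift_dist a x y"
    unfolding shift_dist_def by (intro infsum_nonneg t)
  show "shift_dist a x y = shift_dist a y x"
    by (simp add: shift_dist_def dist_commute)
  show "shift_dist a x y = 0 \<longleftrightarrow> x = y"
  proof
    assume "shift_dist a x y = 0"
    then have "min (1 / (a (nat \<bar>n\<bar>) + 1)) (dist (x n) (y n)) = 0" for n
      by (intro nonneg_infsum_le_0D[OF _ s t]) (simp_all add: shift_dist_def)
    then have "dist (x n) (y n) = 0" for n
      using p[of "nat \<bar>n\<bar>"] by (metis less_irrefl min_def)
    then show "x = y"
      by (simp add: fun_eq_iff)
  next
    assume "x = y"
    moreover have "min (1 / (a (nat \<bar>n\<bar>) + 1)) 0 = 0" for n
      using p[of "nat \<bar>n\<bar>"] by (metis min.absorb2 less_imp_le)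
    ultimately show "shift_dist a x y = 0"
      by (simp add: shift_dist_def)
  qed
  have "shift_dist a x z \<le> (\<Sum>\<^sub>\<infinity>n\<in>UNIV. min (1 / (a (nat \<bar>n\<bar>) + 1)) (dist (x n) (y n)) +
           min (1 / (a (nat \<bar>n\<bar>) + 1)) (dist (y n) (z n)))"
    unfolding shift_dist_def
  proof (intro infsum_mono summable_on_add s)
    fix n
    show "min (1 / (a (nat \<bar>n\<bar>) + 1)) (dist (x n) (z n)) \<le>
      min (1 / (a (nat \<bar>n\<bar>) + 1)) (dist (x n) (y n)) + min (1 / (a (nat \<bar>n\<bar>) + 1)) (dist (y n) (z n))"
      using p[of "nat \<bar>n\<bar>"] dist_triangle[of "x n" "z n" "y n"] 
        zero_le_dist[of "x n" "y n"] zero_le_dist[of "y n" "z n"]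
      unfolding min_def by (smt (verit))
  qed
  also have "\<dots> = shift_dist a x y + shift_dist a y z"
    unfolding shift_dist_def by (intro infsum_add s)
  finally show "shift_dist a x z \<le> shift_dist a x y + shift_dist a y z" .
qed

end

theory Submission
  imports Defs
begin

text \<open>
  Everything rests on measures carried by periodic orbits. They are dense: a Birkhoff average of
  length \<open>p\<close> has the same integral as the function itself, so finitely many integrals are
  approximated by averaging over sample points \<open>x\<^sub>1, \<dots>, x\<^sub>N\<close>, and repeating the words of length \<open>p\<close>
  read off these points gives a periodic point with nearly the same averages.

  Each required property follows from countably many conditions on integrals of continuous
  functions, so it suffices that every such condition holds on a dense set of periodic measures.
  Ergodicity: some Birkhoff average of \<open>f\<close> has variance less than \<open>e\<close>, for \<open>f\<close> in a countable
  determining family; then invariant sets are independent of all \<open>f\<close>, hence of themselves.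
  Hausdorff dimension: almost all mass lies in finitely many tiny balls. Packing dimension: at some
  scale \<open>\<epsilon> \<le> 1/(n+1)\<close> all balls have mass at most \<open>\<epsilon>\<^sup>n\<close>. To achieve the last condition, a periodic
  point is perturbed letter by letter (the alphabet is perfect) so that it contains all binary words of
  length \<open>q\<close>: a ball of radius about \<open>1/a\<^sub>2\<^sub>q\<close> then has mass at most \<open>2\<^sup>-\<^sup>q\<close>, which is smaller than
  any power of the radius because \<open>a\<close> grows subexponentially.
\<close>

text \<open>The two dimension demands seem to exclude each other: a periodic measure is atomic, so
  its packing dimension is 0 as well, and it can never satisfy the packing demand itself. They are
  reconciled because each can be enforced along a sparse sequence of scales. A limsup of covers
  needs a cheap cover only infinitely often, and a packing premeasure below 1 for radii up to
  \<delta> already limits packings of any one common radius \<epsilon> \<le> \<delta>. So condition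
  number n concerns a single scale, which a suitable periodic measure can meet, and the intersection
  over n imposes both behaviours at unrelated scales. Openness forces the indicators of balls to be
  replaced by continuous functions, and this produces the radii: mass is needed on balls of radius 2
  \<epsilon>, a net point turns this into 3 \<epsilon>, the continuous cutoff falls to 0 at 4
  \<epsilon>, and two visits to such a ball are at most 8 \<epsilon> apart, which must stay below
  the weights of the coordinates that tell the visits apart.\<close>

section \<open>Dimension bounds from mass estimates on balls\<close>

text \<open>The centres form a maximal \<open>2\<epsilon>\<close>-separated subset of \<open>F\<close>, so the balls of radius \<open>\<epsilon>\<close> are a packing.\<close>

lemma packing_pre_less_imp_cover:
  assumes "Metric_space UNIV d" and "0 < \<epsilon>" and "\<epsilon> \<le> \<delta>" and pre: "packing_pre\<delta> d \<alpha> \<delta> F < 1"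
  obtains S where "finite S" "real (card S) * (2 * \<epsilon>) powr \<alpha> \<le> 1"
    "F \<subseteq> (\<Union>y\<in>S. Metric_space.mcball UNIV d y (2 * \<epsilon>))"
proof -
  interpret Metric_space UNIV d by fact
  \<comment> \<open>The strict inequality makes the closed \<epsilon>-balls disjoint; its failure
    puts a point into a closed ball of radius \<open>2 * \<epsilon>\<close>.\<close>
  let ?P = "\<lambda>S. finite S \<and> S \<subseteq> F \<and> (\<forall>x\<in>S. \<forall>y\<in>S. x \<noteq> y \<longrightarrow> 2 * \<epsilon> < d x y)"
  have bound: "real (card S) * (2 * \<epsilon>) powr \<alpha> \<le> 1" if S: "?P S" for S
  proof -
    obtain x where x: "bij_betw x {..<card S} S"
      using S ex_bij_betw_nat_finite[of S] by (auto simp: atLeast0LessThan)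
    have "mcball (x i) \<epsilon> \<inter> mcball (x j) \<epsilon> = {}" if "i < card S" "j < card S" "i \<noteq> j" for i j
    proof -
      have "x i \<in> S" "x j \<in> S" "x i \<noteq> x j"
        using x that by (auto simp: bij_betw_def inj_on_def)
      then have far: "2 * \<epsilon> < d (x i) (x j)" using S by blast
      show ?thesis
      proof (rule ccontr)
        assume "mcball (x i) \<epsilon> \<inter> mcball (x j) \<epsilon> \<noteq> {}"
        then obtain w where "d (x i) w \<le> \<epsilon>" "d (x j) w \<le> \<epsilon>" by auto
        then show False using triangle[of "x i" w "x j"] far commute[of w "x j"] by auto
      qed
    qed
    then have "({..<card S}, x, \<lambda>_. \<epsilon>) \<in> packings d \<delta> F"
      using x S \<open>0 < \<epsilon>\<close> \<open>\<epsilon> \<le> \<delta>\<close> unfolding packings_def disjoint_family_on_def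
      by (auto simp: bij_betw_def)
    then have "(\<Sum>\<^sub>\<infinity>k\<in>{..<card S}. ennreal ((2 * \<epsilon>) powr \<alpha>)) \<le> packing_pre\<delta> d \<alpha> \<delta> F"
      unfolding packing_pre\<delta>_def by (intro SUP_upper2) auto
    then have "ennreal (real (card S) * (2 * \<epsilon>) powr \<alpha>) \<le> 1"
      using pre by (simp add: ennreal_mult'' ennreal_of_nat_eq_real_of_nat)
    then show ?thesis by simp
  qed
  have pos: "0 < (2 * \<epsilon>) powr \<alpha>" using \<open>0 < \<epsilon>\<close> by simp
  have lt: "card S < Suc (nat \<lceil>1 / (2 * \<epsilon>) powr \<alpha>\<rceil>)" if "?P S" for S
  proof -
    have "real (card S) \<le> 1 / (2 * \<epsilon>) powr \<alpha>"
      using bound[OF that] pos by (simp add: field_simps)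
    then show ?thesis by linarith
  qed
  \<comment> \<open>A largest separated set exists because the packing bound caps the
    cardinalities.\<close>
  have "\<exists>S. ?P S \<and> (\<forall>S'. ?P S' \<longrightarrow> card S' \<le> card S)"
  proof (rule ex_has_greatest_nat)
    show "?P {}" by simp
    show "\<forall>S. ?P S \<longrightarrow> card S < Suc (nat \<lceil>1 / (2 * \<epsilon>) powr \<alpha>\<rceil>)"
      by (intro allI impI lt)
  qed
  then obtain S where *: "?P S \<and> (\<forall>S'. ?P S' \<longrightarrow> card S' \<le> card S)" ..
  have S: "?P S" by (rule *[THEN conjunct1])
  have max: "card S' \<le> card S" if "?P S'" for S'
    by (rule *[THEN conjunct2, THEN spec, THEN mp, OF that])
  have "F \<subseteq> (\<Union>y\<in>S. mcball y (2 * \<epsilon>))"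
  proof
    fix x assume "x \<in> F"
    show "x \<in> (\<Union>y\<in>S. mcball y (2 * \<epsilon>))"
    proof (rule ccontr)
      assume "x \<notin> (\<Union>y\<in>S. mcball y (2 * \<epsilon>))"
      then have far: "2 * \<epsilon> < d y x" if "y \<in> S" for y
        using that by (force simp: not_le)
      then have "?P (insert x S)"
        using S \<open>x \<in> F\<close> by (auto simp: commute)
      moreover have "x \<notin> S" using far[of x] \<open>0 < \<epsilon>\<close> by auto
      ultimately show False using max[of "insert x S"] S by auto
    qed
  qed
  from that[OF S[THEN conjunct1] bound[OF S] this] show thesis .
qed

lemma sets_borel_metric: "sets (borel_metric d) = sigma_sets UNIV {U. openin (Metric_space.mtopology UNIV d) U}"
  by (simp add: borel_metric_def sets_measure_of_conv)

lemma mcball_in_borel_metric: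
  assumes "Metric_space UNIV d"
  shows "Metric_space.mcball UNIV d x r \<in> sets (borel_metric d)"
proof -
  interpret Metric_space UNIV d by fact
  have "UNIV - mcball x r \<in> sets (borel_metric d)"
    using closedin_mcball[of x r] unfolding sets_borel_metric closedin_def
    by (auto intro!: sigma_sets.Basic)
  then have "UNIV - (UNIV - mcball x r) \<in> sets (borel_metric d)"
    by (metis UNIV_I borel_metric_def sets.compl_sets sets.top space_measure_of_conv)
  then show ?thesis by (simp add: Diff_Diff_Int)
qed

lemma mball_in_borel_metric:
  assumes "Metric_space UNIV d"
  shows "Metric_space.mball UNIV d x r \<in> sets (borel_metric d)"
  using Metric_space.openin_mball[OF assms] by (simp add: sets_borel_metric sigma_sets.Basic)

text \<open>A piece \<open>F\<close> of premeasure below 1 is covered by at most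
  \<open>(2 * \<epsilon>) powr (- \<alpha>)\<close> balls, each of mass at most a higher power of
  \<epsilon>; as \<epsilon> can be taken arbitrarily small, \<open>F\<close> lies in a null set.
  \<open>F\<close> may be nonmeasurable, hence the null superset. A set of positive mass thus has no
  countable cover of total premeasure below 1, for any \<alpha>.\<close>

lemma lower_packing_dim_infinite:
  fixes \<mu> :: "'b measure"
  assumes d: "Metric_space UNIV d"
    and sets: "sets \<mu> = sets (borel_metric d)"
    and small: "\<And>n. \<exists>\<epsilon>>0. \<epsilon> \<le> 1 / real (Suc n) \<and>
      (\<forall>x. emeasure \<mu> (Metric_space.mcball UNIV d x (2 * \<epsilon>)) \<le> ennreal (\<epsilon> ^ n))"
  shows "lower_packing_dim d \<mu> = \<infinity>"
proof -
  interpret Metric_space UNIV d by fact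
  have null: "\<exists>N\<in>null_sets \<mu>. F \<subseteq> N" if "0 < \<alpha>" and pre: "packing_pre d \<alpha> F < 1" for \<alpha> F
  proof -
    obtain \<delta> where "0 < \<delta>" and pre\<delta>: "packing_pre\<delta> d \<alpha> \<delta> F < 1"
      using pre by (auto simp: packing_pre_eq_INF INF_less_iff)
    \<comment> \<open>The hypothesis is used at index \<open>Suc (m + n)\<close>: its scale is then
      at most \<delta> and its exponent exceeds \<alpha> by at least 1. The spare factor \<epsilon>
      is what tends to 0 with \<open>n\<close>.\<close>
    define m where "m = Suc (nat \<lceil>max \<alpha> (1 / \<delta>)\<rceil>)"
    have m: "\<alpha> + 1 \<le> real (m + n) + 1" "1 / \<delta> \<le> real (m + n)" "0 < m" for n
      unfolding m_def by linarith+
    have "\<exists>A\<in>sets \<mu>. F \<subseteq> A \<and> emeasure \<mu> A \<le> ennreal (1 / real (Suc n))" for n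
    proof -
      obtain \<epsilon> where \<epsilon>: "0 < \<epsilon>" "\<epsilon> \<le> 1 / real (Suc (Suc (m + n)))"
        "\<And>x. emeasure \<mu> (mcball x (2 * \<epsilon>)) \<le> ennreal (\<epsilon> ^ (Suc (m + n)))"
        using small[of "Suc (m + n)"] by auto
      have "\<epsilon> \<le> 1 / real (m + n)"
        using \<epsilon>(2) m(3) by (smt (verit, ccfv_SIG) add_gr_0 frac_le le_Suc_eq of_nat_0_less_iff of_nat_le_iff)
      also have "\<dots> \<le> \<delta>" using m(2)[of n] m(3) \<open>0 < \<delta>\<close> by (simp add: field_simps)
      finally obtain S where S: "finite S" "real (card S) * (2 * \<epsilon>) powr \<alpha> \<le> 1" "F \<subseteq> (\<Union>y\<in>S. mcball y (2 * \<epsilon>))"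
        using packing_pre_less_imp_cover[OF d \<open>0 < \<epsilon>\<close> _ pre\<delta>] by blast
      have \<epsilon>1: "\<epsilon> \<le> 1 / real (Suc n)"
        using \<epsilon>(2) by (smt (verit, ccfv_SIG) frac_le le_add2 not_less_eq_eq le_SucI of_nat_0_less_iff of_nat_le_iff zero_less_Suc)
      then have "\<epsilon> \<le> 1" by (smt (verit) divide_le_eq_1_pos of_nat_Suc of_nat_0_le_iff)
      have "emeasure \<mu> (\<Union>y\<in>S. mcball y (2 * \<epsilon>)) \<le> (\<Sum>y\<in>S. emeasure \<mu> (mcball y (2 * \<epsilon>)))"
        by (intro emeasure_subadditive_finite S) (auto simp: sets mcball_in_borel_metric[OF d])
      also have "\<dots> \<le> (\<Sum>y\<in>S. ennreal (\<epsilon> ^ (Suc (m + n))))"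
        by (intro sum_mono \<epsilon>)
      also have "\<dots> = ennreal (real (card S) * \<epsilon> ^ (Suc (m + n)))"
        using \<epsilon>(1) by (simp add: ennreal_mult'' ennreal_of_nat_eq_real_of_nat del: power_Suc)
      also have "\<dots> \<le> ennreal (1 / real (Suc n))"
      proof (rule ennreal_leI)
        have "\<epsilon> ^ (Suc (m + n)) = \<epsilon> powr (real (Suc (m + n)))"
          using \<epsilon>(1) by (simp only: powr_realpow)
        also have "\<dots> \<le> \<epsilon> powr (\<alpha> + 1)"
          using m(1)[of n] \<epsilon>(1) \<open>\<epsilon> \<le> 1\<close> by (intro powr_mono') auto
        also have "\<dots> = \<epsilon> powr \<alpha> * \<epsilon>" using \<epsilon>(1) by (simp add: powr_add)
        also have "\<dots> \<le> (2 * \<epsilon>) powr \<alpha> * \<epsilon>"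
          using \<epsilon>(1) \<open>0 < \<alpha>\<close> by (intro mult_right_mono powr_mono2) auto
        finally have "real (card S) * \<epsilon> ^ (Suc (m + n)) \<le> (real (card S) * (2 * \<epsilon>) powr \<alpha>) * \<epsilon>"
          by (metis mult.assoc mult_left_mono of_nat_0_le_iff)
        also have "\<dots> \<le> 1 * \<epsilon>"
          using S(2) \<epsilon>(1) by (intro mult_right_mono) auto
        finally show "real (card S) * \<epsilon> ^ (Suc (m + n)) \<le> 1 / real (Suc n)"
          using \<epsilon>1 by linarith
      qed
      finally show ?thesis
        using S by (intro bexI[of _ "\<Union>y\<in>S. mcball y (2 * \<epsilon>)"] conjI)
          (auto simp: sets intro!: sets.finite_UN mcball_in_borel_metric[OF d])
    qed
    then obtain A where A: "\<And>n. A n \<in> sets \<mu>" "\<And>n. F \<subseteq> A n"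
      "\<And>n. emeasure \<mu> (A n) \<le> ennreal (1 / real (Suc n))" by metis
    have "emeasure \<mu> (\<Inter>n. A n) \<le> ennreal (1 / real (Suc n))" for n
      using A by (intro order_trans[OF emeasure_mono A(3)]) auto
    moreover have "(\<lambda>n. ennreal (1 / real (Suc n))) \<longlonglongrightarrow> ennreal 0"
      by (intro tendsto_ennrealI LIMSEQ_inverse_real_of_nat[unfolded inverse_eq_divide])
    ultimately have "emeasure \<mu> (\<Inter>n. A n) \<le> ennreal 0"
      by (intro LIMSEQ_le_const) auto
    then show ?thesis
      using A by (intro bexI[of _ "\<Inter>n. A n"]) auto
  qed
  have inf: "packing_dim d E = \<infinity>" if E: "E \<in> sets (borel_metric d)" "emeasure \<mu> E > 0" for E
  proof -
    have "packing_measure d \<alpha> E \<noteq> 0" if \<alpha>: "0 < \<alpha>" for \<alpha>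
    proof
      assume "packing_measure d \<alpha> E = 0"
      then have "packing_measure d \<alpha> E < 1" by simp
      then obtain F :: "nat \<Rightarrow> 'b set" where F: "E \<subseteq> (\<Union>i. F i)" "(\<Sum>i. packing_pre d \<alpha> (F i)) < 1"
        unfolding packing_measure_def by (auto simp: INF_less_iff)
      have "packing_pre d \<alpha> (F i) < 1" for i
      proof -
        have "(\<Sum>i\<in>{i}. packing_pre d \<alpha> (F i)) \<le> (\<Sum>i. packing_pre d \<alpha> (F i))"
          by (rule sum_le_suminf) auto
        then show ?thesis using F(2) by auto
      qed
      then have "\<forall>i. \<exists>N. N \<in> null_sets \<mu> \<and> F i \<subseteq> N"
        using null[OF \<alpha>] by blast
      then obtain N where N: "\<And>i. N i \<in> null_sets \<mu>" "\<And>i. F i \<subseteq> N i"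
        by metis
      have "E \<subseteq> (\<Union>i. N i)" using F(1) N(2) by blast
      moreover have "(\<Union>i. N i) \<in> null_sets \<mu>" using N by auto
      ultimately have "E \<in> null_sets \<mu>"
        using E sets by (intro null_sets_subset[where A=E and B="\<Union>i. N i"]) auto
      then show False using E by auto
    qed
    \<comment> \<open>No exponent qualifies, and the infimum of the empty set in
      \<open>ennreal\<close> is top.\<close>
    then have "{ennreal \<alpha> |\<alpha>. 0 < \<alpha> \<and> packing_measure d \<alpha> E = 0} = {}" by auto
    then show ?thesis unfolding packing_dim_def by (simp only: Inf_empty infinity_ennreal_def)
  qed
  then have "\<infinity> \<le> lower_packing_dim d \<mu>"
    unfolding lower_packing_dim_def
    by (intro Inf_greatest) (elim CollectE exE conjE, simp only: inf)
  then show ?thesis by (simp add: top_unique)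
qed

section \<open>Hausdorff dimension of limsup sets of balls\<close>

lemma mdiam_mball_le:
  assumes "Metric_space UNIV d"
  shows "mdiam d (Metric_space.mball UNIV d x r) \<le> ennreal (2 * r)"
proof -
  interpret Metric_space UNIV d by fact
  have "d y z \<le> 2 * r" if "y \<in> mball x r" "z \<in> mball x r" for y z
    using that triangle[of y x z] commute[of x y] by auto
  then show ?thesis unfolding mdiam_def by (intro SUP_least ennreal_leI) auto
qed

text \<open>For every \<open>N\<close> the balls of index at least \<open>N\<close> cover the set.
  Once \<open>1 / real (Suc n) \<le> \<alpha>\<close>, diameters at most 1 make the cost of stage
  \<open>n\<close> at exponent \<alpha> no larger than at \<open>1 / real (Suc n)\<close>, so the
  total is at most a geometric tail. Exponents that decrease with \<open>n\<close> serve all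
  \<alpha> at once.\<close>

lemma hausdorff_dim_limsup_zero:
  assumes d: "Metric_space UNIV d"
    and Y: "\<And>n. finite (Y n)" and \<rho>0: "\<And>n. 0 < \<rho> n" and \<rho>: "\<And>n::nat. 2 * \<rho> n \<le> (1 / 2) ^ n"
    and sum: "\<And>n::nat. real (card (Y n)) * (2 * \<rho> n) powr (1 / real (Suc n)) \<le> (1 / 2) ^ n"
  shows "hausdorff_dim d (\<Inter>N. \<Union>n\<in>{N..}. \<Union>y\<in>Y n. Metric_space.mball UNIV d y (\<rho> n)) = 0"
    (is "hausdorff_dim d ?E = 0")
proof -
  interpret Metric_space UNIV d by fact
  have *: "hausdorff_pre d \<alpha> \<delta> ?E = 0" if "0 < \<alpha>" "0 < \<delta>" for \<alpha> \<delta>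
  proof -
    \<comment> \<open>From \<open>N0\<close> on the exponents \<open>1 / real (Suc n)\<close> are at
      most \<alpha>; from \<open>N1\<close> on the diameters are at most \<delta>.\<close>
    obtain N0 where N0: "1 / \<alpha> \<le> real N0" using real_arch_simple by blast
    obtain N1 where N1: "(1/2)^N1 < \<delta>" using real_arch_pow_inv[OF \<open>0 < \<delta>\<close>, of "1/2"] by auto
    have bound: "hausdorff_pre d \<alpha> \<delta> ?E \<le> ennreal (2 * (1/2)^N)" if N: "N \<ge> max N0 N1" for N
    proof -
      obtain y where y: "\<And>n. bij_betw (y n) {..<card (Y n)} (Y n)"
        using ex_bij_betw_nat_finite[OF Y] by (metis atLeast0LessThan)
      define U where "U p = (case prod_decode p of (n, j) \<Rightarrow>
         if N \<le> n \<and> j < card (Y n) then mball (y n j) (\<rho> n) else {})" for p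
      have mdiam_empty: "mdiam d {} = 0" by (simp add: mdiam_def bot_ennreal)
      have cov: "?E \<subseteq> (\<Union>k. U k)"
      proof
        fix x assume "x \<in> ?E"
        then obtain n u where n: "N \<le> n" "u \<in> Y n" "x \<in> mball u (\<rho> n)" by blast
        then obtain j where "j < card (Y n)" "u = y n j"
          using y[of n] by (auto simp: bij_betw_def)
        then have "x \<in> U (prod_encode (n, j))" using n by (simp add: U_def)
        then show "x \<in> (\<Union>k. U k)" by blast
      qed
      have small: "2 * \<rho> n \<le> \<delta>" if "N \<le> n" for n
      proof -
        have "(1/2::real)^n \<le> (1/2)^N1" using that N by (intro power_decreasing) auto
        then show ?thesis using \<rho>[of n] N1 by linarith
      qed
      have diam: "mdiam d (U k) \<le> ennreal \<delta>" for k
        using small order_trans[OF mdiam_mball_le[OF d] ennreal_leI]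
        by (auto simp: U_def mdiam_empty split: prod.split)
      have tm: "enn2real (mdiam d (mball (y n j) (\<rho> n))) powr \<alpha>
          \<le> (2 * \<rho> n) powr (1 / real (Suc n))" if "N \<le> n" for n j
      proof -
        have "enn2real (mdiam d (mball (y n j) (\<rho> n))) \<le> 2 * \<rho> n"
          using mdiam_mball_le[OF d, of "y n j" "\<rho> n"] \<rho>0[of n] by (intro enn2real_leI) auto
        then have "enn2real (mdiam d (mball (y n j) (\<rho> n))) powr \<alpha> \<le> (2 * \<rho> n) powr \<alpha>"
          using \<open>0 < \<alpha>\<close> by (intro powr_mono2) auto
        also have "\<dots> \<le> (2 * \<rho> n) powr (1 / real (Suc n))"
        proof (rule powr_mono')
          have "1 / \<alpha> \<le> real (Suc n)" using N0 N that by simp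
          then show "1 / real (Suc n) \<le> \<alpha>" using \<open>0 < \<alpha>\<close> by (simp add: field_simps)
          show "2 * \<rho> n \<le> 1" using \<rho>[of n] power_le_one[of "1/2::real" n] by simp
          show "0 \<le> 2 * \<rho> n" using \<rho>0[of n] by simp
        qed
        finally show ?thesis .
      qed
      define t where "t p = (case p of (n, j) \<Rightarrow> if N \<le> n \<and> j < card (Y n)
         then ennreal ((2 * \<rho> n) powr (1 / real (Suc n))) else 0)" for p
      have "(\<Sum>k. ennreal (enn2real (mdiam d (U k)) powr \<alpha>)) \<le> (\<Sum>k. t (prod_decode k))"
        by (intro suminf_le) (auto simp: U_def t_def mdiam_empty tm simp del: of_nat_Suc intro!: ennreal_leI split: prod.split)
      also have "\<dots> = (\<Sum>n. \<Sum>j. t (n, j))"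
        by (rule suminf_ennreal_2dimen) simp
      also have "\<dots> \<le> (\<Sum>n. if N \<le> n then ennreal ((1/2)^n) else 0)"
      proof (intro suminf_le)
        fix n
        have "(\<Sum>j. t (n, j)) = (\<Sum>j<card (Y n). t (n, j))"
          by (rule suminf_finite) (auto simp: t_def)
        also have "\<dots> \<le> (if N \<le> n then ennreal ((1/2)^n) else 0)"
        proof (cases "N \<le> n")
          case True
          then have "(\<Sum>j<card (Y n). t (n, j)) = (\<Sum>j<card (Y n). ennreal ((2 * \<rho> n) powr (1 / real (Suc n))))"
            by (intro sum.cong) (auto simp: t_def)
          also have "\<dots> = ennreal (real (card (Y n)) * (2 * \<rho> n) powr (1 / real (Suc n)))"
            by (simp add: ennreal_mult'' ennreal_of_nat_eq_real_of_nat)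
          also have "\<dots> \<le> ennreal ((1/2)^n)" by (intro ennreal_leI sum)
          finally show ?thesis using True by simp
        qed (simp add: t_def)
        finally show "(\<Sum>j. t (n, j)) \<le> (if N \<le> n then ennreal ((1/2)^n) else 0)" .
      qed auto
      also have "\<dots> = (\<Sum>n. if N \<le> n + N then ennreal ((1/2)^(n + N)) else 0)"
        by (subst suminf_offset[of "\<lambda>n. if N \<le> n then ennreal ((1/2)^n) else 0" N]) auto
      also have "\<dots> = ennreal (2 * (1/2)^N)"
      proof -
        have "(\<lambda>n. (1/2::real)^n * (1/2)^N) sums (2 * (1/2)^N)"
          using geometric_sums[of "1/2::real"] by (intro sums_mult2) simp
        then have "(\<Sum>n. ennreal ((1/2)^n * (1/2)^N)) = ennreal (2 * (1/2)^N)"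
          by (intro suminf_ennreal_eq) auto
        then show ?thesis by (simp only: power_add le_add2 if_True)
      qed
      finally have "(\<Sum>k. ennreal (enn2real (mdiam d (U k)) powr \<alpha>)) \<le> ennreal (2 * (1/2)^N)" .
      then show ?thesis unfolding hausdorff_pre_def
        using cov diam by (intro INF_lower2[of U]) auto
    qed
    have "(\<lambda>N. ennreal (2 * (1/2)^N)) \<longlonglongrightarrow> ennreal (2 * 0)"
      by (intro tendsto_ennrealI tendsto_mult tendsto_const LIMSEQ_power_zero) auto
    then have "hausdorff_pre d \<alpha> \<delta> ?E \<le> ennreal (2 * 0)"
      using bound by (intro LIMSEQ_le_const) blast+
    then show ?thesis by simp
  qed
  have "hausdorff_measure d \<alpha> ?E = 0" if "0 < \<alpha>" for \<alpha>
    unfolding hausdorff_measure_eq_SUP by (subst SUP_eq_const[of _ _ 0]) (auto simp: * that simp del: INT_iff UN_simps)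
  then have "hausdorff_dim d ?E \<le> ennreal (1 / real (Suc n))" for n
    unfolding hausdorff_dim_def by (intro Inf_lower) force
  moreover have "(\<lambda>n. ennreal (1 / real (Suc n))) \<longlonglongrightarrow> ennreal 0"
    by (intro tendsto_ennrealI LIMSEQ_inverse_real_of_nat[unfolded inverse_eq_divide])
  ultimately have "hausdorff_dim d ?E \<le> ennreal 0"
    by (intro LIMSEQ_le_const) auto
  then show ?thesis by simp
qed

text \<open>The limsup of the ball unions has full measure: each tail union contains sets of mass at
  least \<open>1 - 1 / real (Suc n)\<close> with \<open>n\<close> arbitrarily large, so monotonicity
  gives it probability 1.\<close>

lemma upper_hausdorff_dim_zero:
  assumes d: "Metric_space UNIV d" and "prob_space \<mu>" and sets: "sets \<mu> = sets (borel_metric d)"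
    and ex: "\<And>n::nat. \<exists>Y \<rho>. finite Y \<and> 0 < \<rho> \<and> 2 * \<rho> \<le> (1 / 2) ^ n \<and>
      real (card Y) * (2 * \<rho>) powr (1 / real (Suc n)) \<le> (1 / 2) ^ n \<and>
      1 - 1 / real (Suc n) \<le> measure \<mu> (\<Union>y\<in>Y. Metric_space.mball UNIV d y \<rho>)"
  shows "upper_hausdorff_dim d \<mu> = 0"
proof -
  interpret Metric_space UNIV d by fact
  interpret prob_space \<mu> by fact
  obtain Y \<rho> where Y: "\<And>n. finite (Y n)" "\<And>n. 0 < \<rho> n" "\<And>n::nat. 2 * \<rho> n \<le> (1 / 2) ^ n"
    "\<And>n::nat. real (card (Y n)) * (2 * \<rho> n) powr (1 / real (Suc n)) \<le> (1 / 2) ^ n"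
    "\<And>n. 1 - 1 / real (Suc n) \<le> measure \<mu> (\<Union>y\<in>Y n. mball y (\<rho> n))"
    using ex by metis
  define U where "U n = (\<Union>y\<in>Y n. mball y (\<rho> n))" for n
  define E where "E = (\<Inter>N. \<Union>n\<in>{N..}. U n)"
  have U [measurable]: "U n \<in> sets \<mu>" for n
    unfolding U_def sets by (intro sets.finite_UN Y mball_in_borel_metric d)
  have E [measurable]: "E \<in> sets \<mu>" unfolding E_def by measurable
  have "space \<mu> = UNIV" using sets_eq_imp_space_eq[OF sets] by (simp add: borel_metric_def)
  have "prob (\<Union>n\<in>{N..}. U n) = 1" for N
  proof (rule antisym)
    have "1 - 1 / real (Suc n) \<le> prob (\<Union>n\<in>{N..}. U n)" if "n \<ge> N" for n
      using Y(5)[of n] that by (intro order_trans[OF Y(5) finite_measure_mono]) (auto simp: U_def[symmetric])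
    moreover have "(\<lambda>n. 1 - 1 / real (Suc n)) \<longlonglongrightarrow> 1 - 0"
      by (intro tendsto_diff tendsto_const LIMSEQ_inverse_real_of_nat[unfolded inverse_eq_divide])
    ultimately have "1 - 0 \<le> prob (\<Union>n\<in>{N..}. U n)"
      by (intro LIMSEQ_le_const2) auto
    then show "1 \<le> prob (\<Union>n\<in>{N..}. U n)" by simp
  qed simp
  then have "AE x in \<mu>. x \<in> (\<Union>n\<in>{N..}. U n)" for N
    by (subst AE_in_set_eq_1) auto
  then have "AE x in \<mu>. \<forall>N. x \<in> (\<Union>n\<in>{N..}. U n)" by (simp only: AE_all_countable) blast
  then have "AE x in \<mu>. x \<in> E" unfolding E_def by (simp only: INT_iff ball_UNIV)
  then have "emeasure \<mu> (UNIV - E) = 0"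
    using AE_iff_measurable[of "UNIV - E" \<mu> "\<lambda>x. x \<in> E"] sets.compl_sets[OF E]
    by (auto simp: \<open>space \<mu> = UNIV\<close>)
  moreover have "hausdorff_dim d E = 0"
    unfolding E_def U_def by (intro hausdorff_dim_limsup_zero d Y)
  ultimately have "upper_hausdorff_dim d \<mu> \<le> 0"
    using E sets unfolding upper_hausdorff_dim_def by (intro Inf_lower) force
  then show ?thesis by simp
qed

section \<open>Empirical averages, weak topology and ergodicity\<close>

lemma (in prob_space) exists_le_expectation:
  fixes h :: "'a \<Rightarrow> real"
  assumes "integrable M h"
  shows "\<exists>x\<in>space M. h x \<le> expectation h"
proof (rule ccontr)
  assume "\<not> ?thesis"
  then have "AE x in M. expectation h < h x" by (intro AE_I2) (auto simp: not_le)
  then have "expectation h < expectation h"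
    using expectation_greater[OF assms, of "expectation h"] by simp
  then show False by simp
qed

text \<open>
  The points are chosen greedily: since the fluctuations are centred, each step can be taken such
  that the sum of the squares of the accumulated errors grows by at most a constant.
\<close>

lemma (in prob_space) empirical_approximation:
  fixes G :: "'i \<Rightarrow> 'a \<Rightarrow> real"
  assumes "finite I" and meas [measurable]: "\<And>i. i \<in> I \<Longrightarrow> G i \<in> borel_measurable M"
    and B: "\<And>i x. i \<in> I \<Longrightarrow> \<bar>G i x\<bar> \<le> B" and "0 < \<epsilon>"
  shows "\<exists>N>0. \<exists>x. \<forall>i\<in>I. \<bar>(\<Sum>j<N. G i (x j)) / real N - expectation (G i)\<bar> < \<epsilon>"
proof -
  have int: "integrable M (G i)" if "i \<in> I" for i
    using B[OF that] that by (intro integrable_const_bound[where B=B]) auto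
  define g where "g i x = G i x - expectation (G i)" for i x
  have g_bound: "\<bar>g i x\<bar> \<le> 2 * B" if "i \<in> I" for i x
  proof -
    have "\<bar>expectation (G i)\<bar> \<le> expectation (\<lambda>x. \<bar>G i x\<bar>)" by simp
    also have "\<dots> \<le> expectation (\<lambda>x. B)"
      using int[OF that] B[OF that] by (intro integral_mono) auto
    finally show ?thesis using B[OF that, of x] by (simp add: g_def prob_space)
  qed
  have g_meas [measurable]: "g i \<in> borel_measurable M" if "i \<in> I" for i
    unfolding g_def using that by measurable
  have g_int: "integrable M (g i)" if "i \<in> I" for i
    using int[OF that] unfolding g_def by simp
  have g_zero: "expectation (g i) = 0" if "i \<in> I" for i
    using int[OF that] unfolding g_def by (simp add: prob_space)
  have g2: "(g i x)\<^sup>2 \<le> (2 * B)\<^sup>2" if "i \<in> I" for i x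
    using g_bound[OF that, of x] by (metis abs_le_square_iff abs_ge_zero abs_of_nonneg order_trans)
  have g2_int: "integrable M (\<lambda>x. (g i x)\<^sup>2)" if "i \<in> I" for i
    using g2[OF that] that by (intro integrable_const_bound[where B="(2 * B)\<^sup>2"]) auto
  define K where "K = real (card I) * (2 * B)\<^sup>2"
  have step: "\<exists>x. (\<Sum>i\<in>I. (S i + g i x)\<^sup>2) \<le> (\<Sum>i\<in>I. (S i)\<^sup>2) + K" for S
  proof -
    have eq: "(S i + g i x)\<^sup>2 = (S i)\<^sup>2 + 2 * S i * g i x + (g i x)\<^sup>2" for i x
      by (simp add: power2_eq_square algebra_simps)
    have int': "integrable M (\<lambda>x. (S i + g i x)\<^sup>2)" if "i \<in> I" for i
      unfolding eq using g_int[OF that] g2_int[OF that] by auto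
    have "expectation (\<lambda>x. \<Sum>i\<in>I. (S i + g i x)\<^sup>2) = (\<Sum>i\<in>I. expectation (\<lambda>x. (S i + g i x)\<^sup>2))"
      by (intro Bochner_Integration.integral_sum int')
    also have "\<dots> = (\<Sum>i\<in>I. (S i)\<^sup>2 + expectation (\<lambda>x. (g i x)\<^sup>2))"
      by (intro sum.cong refl) (simp add: eq g_int g2_int g_zero prob_space)
    also have "\<dots> \<le> (\<Sum>i\<in>I. (S i)\<^sup>2 + (2 * B)\<^sup>2)"
    proof (intro sum_mono add_left_mono)
      fix i assume "i \<in> I"
      then have "expectation (\<lambda>x. (g i x)\<^sup>2) \<le> expectation (\<lambda>x. (2 * B)\<^sup>2)"
        by (intro integral_mono g2_int g2) auto
      then show "expectation (\<lambda>x. (g i x)\<^sup>2) \<le> (2 * B)\<^sup>2" by (simp add: prob_space)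
    qed
    also have "\<dots> = (\<Sum>i\<in>I. (S i)\<^sup>2) + K" by (simp add: K_def sum.distrib)
    finally have "expectation (\<lambda>x. \<Sum>i\<in>I. (S i + g i x)\<^sup>2) \<le> (\<Sum>i\<in>I. (S i)\<^sup>2) + K" .
    moreover have "integrable M (\<lambda>x. \<Sum>i\<in>I. (S i + g i x)\<^sup>2)"
      by (intro Bochner_Integration.integrable_sum int')
    ultimately show ?thesis
      using exists_le_expectation order_trans by blast
  qed
  have greedy: "\<exists>x. (\<Sum>i\<in>I. (\<Sum>j<N. g i (x j))\<^sup>2) \<le> real N * K" for N :: nat
  proof (induction N)
    case (Suc N)
    then obtain x where x: "(\<Sum>i\<in>I. (\<Sum>j<N. g i (x j))\<^sup>2) \<le> real N * K" by blast
    obtain y where y: "(\<Sum>i\<in>I. ((\<Sum>j<N. g i (x j)) + g i y)\<^sup>2) \<le> (\<Sum>i\<in>I. (\<Sum>j<N. g i (x j))\<^sup>2) + K"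
      using step[of "\<lambda>i. \<Sum>j<N. g i (x j)"] by blast
    have "(\<Sum>j<Suc N. g i ((x(N := y)) j)) = (\<Sum>j<N. g i (x j)) + g i y" for i
      by (auto intro!: sum.cong)
    then show ?case using x y by (intro exI[of _ "x(N := y)"]) (simp add: algebra_simps)
  qed simp
  \<comment> \<open>Each accumulated error is at most \<open>sqrt (N * K)\<close>, of smaller order
    than \<open>N * \<epsilon>\<close>; this \<open>N\<close> makes it strictly smaller.\<close>
  obtain N where N: "K / \<epsilon>\<^sup>2 < real N" using reals_Archimedean2 by blast
  have "0 \<le> K" by (simp add: K_def)
  then have "0 \<le> K / \<epsilon>\<^sup>2" by simp
  then have "0 < N" using N by (metis of_nat_0_less_iff order_le_less_trans)
  obtain x where x: "(\<Sum>i\<in>I. (\<Sum>j<N. g i (x j))\<^sup>2) \<le> real N * K" using greedy by blast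
  have "\<bar>(\<Sum>j<N. G i (x j)) / real N - expectation (G i)\<bar> < \<epsilon>" if "i \<in> I" for i
  proof -
    have "(\<Sum>j<N. g i (x j))\<^sup>2 \<le> (\<Sum>i\<in>I. (\<Sum>j<N. g i (x j))\<^sup>2)"
      using that \<open>finite I\<close> by (intro member_le_sum) auto
    also have "\<dots> \<le> real N * K" by (fact x)
    also have "\<dots> < real N * (real N * \<epsilon>\<^sup>2)"
      using N \<open>0 < N\<close> \<open>0 < \<epsilon>\<close> by (intro mult_strict_left_mono) (auto simp: field_simps)
    also have "\<dots> = (real N * \<epsilon>)\<^sup>2" by (simp add: power2_eq_square)
    finally have "\<bar>\<Sum>j<N. g i (x j)\<bar>\<^sup>2 < (real N * \<epsilon>)\<^sup>2" by simp
    then have "\<bar>\<Sum>j<N. g i (x j)\<bar> < real N * \<epsilon>"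
      by (rule power2_less_imp_less) (use \<open>0 < \<epsilon>\<close> in simp)
    moreover have "(\<Sum>j<N. g i (x j)) = real N * ((\<Sum>j<N. G i (x j)) / real N - expectation (G i))"
      using \<open>0 < N\<close> by (simp add: g_def sum_subtractf right_diff_distrib)
    ultimately show ?thesis
      using \<open>0 < N\<close> by (simp add: abs_mult)
  qed
  then show ?thesis using \<open>0 < N\<close> by blast
qed

section \<open>The weak topology in terms of integrals\<close>

lemma space_invariant_measure:
  assumes "\<mu> \<in> invariant_measures d T"
  shows "space \<mu> = UNIV"
  using assms sets_eq_imp_space_eq[of \<mu> "borel_metric d"]
  by (simp add: borel_metric_def invariant_measures_def)

lemma continuous_map_dist_from:
  assumes "Metric_space UNIV d"
  shows "continuous_map (Metric_space.mtopology UNIV d) euclideanreal (d y)"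
proof -
  interpret Metric_space UNIV d by fact
  have "continuous_map (mtopology_of (metric (UNIV, d))) euclidean (\<lambda>x. mdist (metric (UNIV, d)) y x)"
    by (intro continuous_intros) (auto simp: mtopology_of_def)
  then show ?thesis by (simp add: mtopology_of_def)
qed

lemma bounded_continuousI:
  assumes "continuous_map (Metric_space.mtopology UNIV d) euclideanreal f" and "\<And>x. \<bar>f x\<bar> \<le> B"
  shows "f \<in> bounded_continuous d"
  using assms by (auto simp: bounded_continuous_def bounded_iff)

lemma bounded_continuous_measurable:
  assumes "Metric_space UNIV d" "f \<in> bounded_continuous d" "sets \<mu> = sets (borel_metric d)"
  shows "f \<in> borel_measurable \<mu>"
proof (rule borel_measurableI)
  interpret Metric_space UNIV d by fact
  fix S :: "real set" assume "open S"
  then have "openin mtopology {x \<in> topspace mtopology. f x \<in> S}"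
    using assms(2) unfolding bounded_continuous_def
    by (intro openin_continuous_map_preimage[of _ euclideanreal]) auto
  moreover have "space \<mu> = UNIV"
    using sets_eq_imp_space_eq[OF assms(3)] by (simp add: borel_metric_def)
  ultimately show "f -` S \<inter> space \<mu> \<in> sets \<mu>"
    by (simp add: assms(3) sets_borel_metric vimage_def sigma_sets.Basic)
qed

lemma bounded_continuousE:
  assumes "f \<in> bounded_continuous d"
  obtains B where "\<And>x. \<bar>f x\<bar> \<le> B"
  using assms by (auto simp: bounded_continuous_def bounded_iff)

lemma bounded_continuous_integrable:
  assumes "Metric_space UNIV d" "f \<in> bounded_continuous d" "\<mu> \<in> invariant_measures d T"
  shows "integrable \<mu> f"
proof -
  interpret prob_space \<mu> using assms by (simp add: invariant_measures_def)
  obtain B where B: "\<And>x. \<bar>f x\<bar> \<le> B" using assms(2) bounded_continuousE by blast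
  have "f \<in> borel_measurable \<mu>"
    using assms by (intro bounded_continuous_measurable[OF assms(1)]) (auto simp: invariant_measures_def)
  then show ?thesis
    using B by (intro integrable_const_bound[where B=B]) auto
qed

lemma continuous_map_weak_integral:
  assumes "f \<in> bounded_continuous d"
  shows "continuous_map (weak_topology d T) euclideanreal (\<lambda>\<mu>. \<integral>x. f x \<partial>\<mu>)"
proof -
  have "continuous_map (weak_topology d T) (product_topology (\<lambda>_. euclideanreal) (bounded_continuous d))
     (id \<circ> (\<lambda>\<mu>. \<lambda>f\<in>bounded_continuous d. \<integral>x. f x \<partial>\<mu>))"
    unfolding weak_topology_def id_o
    using continuous_map_pullback[OF continuous_map_id] by (metis id_o)
  from continuous_map_compose[OF this continuous_map_product_projection[OF assms]]
  show ?thesis using assms by (simp add: o_def)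
qed

text \<open>A basic open set of the product topology constrains only finitely many integrals, and
  each constraint, being open, contains an interval around the integral for \<mu>.\<close>

lemma weak_topology_basis:
  assumes "openin (weak_topology d T) U" "\<mu> \<in> U"
  obtains F \<epsilon> where "finite F" "F \<subseteq> bounded_continuous d" "0 < \<epsilon>"
    "\<And>\<nu>. \<nu> \<in> invariant_measures d T \<Longrightarrow>
      (\<And>f. f \<in> F \<Longrightarrow> \<bar>(\<integral>x. f x \<partial>\<nu>) - (\<integral>x. f x \<partial>\<mu>)\<bar> < \<epsilon>) \<Longrightarrow> \<nu> \<in> U"
proof -
  let ?I = "bounded_continuous d"
  let ?g = "\<lambda>\<mu>. \<lambda>f\<in>?I. \<integral>x. f x \<partial>\<mu>"
  obtain V where V: "openin (product_topology (\<lambda>_. euclideanreal) ?I) V"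
    "U = ?g -` V \<inter> invariant_measures d T"
    using assms(1) by (auto simp: weak_topology_def openin_pullback_topology)
  have "?g \<mu> \<in> V" using assms(2) V(2) by auto
  from product_topology_open_contains_basis[OF V(1) this]
  obtain W where W: "finite {f. W f \<noteq> UNIV}" "\<And>f. open (W f)"
    "?g \<mu> \<in> PiE ?I W" "PiE ?I W \<subseteq> V" by (elim exE conjE) simp
  define F where "F = {f \<in> ?I. W f \<noteq> UNIV}"
  have "\<exists>e>0. \<forall>t. \<bar>t - (\<integral>x. f x \<partial>\<mu>)\<bar> < e \<longrightarrow> t \<in> W f" if "f \<in> F" for f
  proof -
    have "(\<integral>x. f x \<partial>\<mu>) \<in> W f" "open (W f)"
      using that W by (auto simp: F_def PiE_iff)
    then show ?thesis unfolding open_dist by (auto simp: dist_real_def)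
  qed
  then obtain e where e: "\<And>f. f \<in> F \<Longrightarrow> 0 < e f"
    "\<And>f t. f \<in> F \<Longrightarrow> \<bar>t - (\<integral>x. f x \<partial>\<mu>)\<bar> < e f \<Longrightarrow> t \<in> W f"
    by metis
  have "finite F" using W(1) by (simp add: F_def)
  \<comment> \<open>Inserting 1 keeps \<open>Min\<close> meaningful when \<open>F\<close> is
    empty.\<close>
  define \<epsilon> where "\<epsilon> = Min (insert 1 (e ` F))"
  have "0 < \<epsilon>" using e(1) \<open>finite F\<close> by (auto simp: \<epsilon>_def)
  have \<epsilon>_le: "\<epsilon> \<le> e f" if "f \<in> F" for f
    using that \<open>finite F\<close> by (auto simp: \<epsilon>_def)
  show thesis
  proof (rule that[of F \<epsilon>])
    fix \<nu> assume \<nu>: "\<nu> \<in> invariant_measures d T"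
      "\<And>f. f \<in> F \<Longrightarrow> \<bar>(\<integral>x. f x \<partial>\<nu>) - (\<integral>x. f x \<partial>\<mu>)\<bar> < \<epsilon>"
    have "(\<integral>x. f x \<partial>\<nu>) \<in> W f" if "f \<in> ?I" for f
    proof (cases "f \<in> F")
      case True
      then show ?thesis using \<nu>(2)[OF True] \<epsilon>_le[OF True] by (intro e(2)) auto
    next
      case False
      then show ?thesis using that by (auto simp: F_def)
    qed
    then have "?g \<nu> \<in> PiE ?I W" by auto
    then have "?g \<nu> \<in> V" using W(4) by (rule rev_subsetD)
    then show "\<nu> \<in> U" using V(2) \<nu>(1) by simp
  qed (use \<open>finite F\<close> \<open>0 < \<epsilon>\<close> in \<open>auto simp: F_def\<close>)
qed

lemma distr_invariant:
  assumes "\<mu> \<in> invariant_measures d T" and T: "T \<in> measurable \<mu> \<mu>"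
  shows "distr \<mu> \<mu> T = \<mu>"
proof (rule measure_eqI)
  show "emeasure (distr \<mu> \<mu> T) A = emeasure \<mu> A" if "A \<in> sets (distr \<mu> \<mu> T)" for A
    using assms that space_invariant_measure[OF assms(1)] by (auto simp: emeasure_distr invariant_measures_def)
qed simp

lemma integral_invariant:
  fixes f :: "'b \<Rightarrow> real"
  assumes "\<mu> \<in> invariant_measures d T" and [measurable]: "T \<in> measurable \<mu> \<mu>" "f \<in> borel_measurable \<mu>"
  shows "(\<integral>x. f ((T ^^ i) x) \<partial>\<mu>) = (\<integral>x. f x \<partial>\<mu>)"
proof (induction i)
  case (Suc i)
  have "(\<integral>x. f ((T ^^ i) x) \<partial>\<mu>) = (\<integral>x. f ((T ^^ i) x) \<partial>(distr \<mu> \<mu> T))"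
    using distr_invariant[OF assms(1,2)] by simp
  also have "\<dots> = (\<integral>x. f ((T ^^ i) (T x)) \<partial>\<mu>)"
    by (rule integral_distr) measurable
  finally show ?case using Suc by (simp add: funpow_swap1)
qed simp

section \<open>Ergodicity from small variance of Birkhoff averages\<close>

definition birkhoff_avg :: "('b \<Rightarrow> 'b) \<Rightarrow> nat \<Rightarrow> ('b \<Rightarrow> real) \<Rightarrow> 'b \<Rightarrow> real" where
  "birkhoff_avg T N f x = (\<Sum>i<N. f ((T ^^ i) x)) / real N"

text \<open>The indicator of an invariant set is constant along orbits, so the product with
  \<open>f\<close> is composed with the iterates as a whole and invariance of \<mu> applies to it.
  \<open>A = UNIV\<close> shows that a Birkhoff average has the mean of \<open>f\<close>.\<close>

lemma birkhoff_avg_invariant_set: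
  fixes f :: "'b \<Rightarrow> real"
  assumes \<mu>: "\<mu> \<in> invariant_measures d T" and T [measurable]: "T \<in> measurable \<mu> \<mu>"
    and f [measurable]: "f \<in> borel_measurable \<mu>" and B: "\<And>x. \<bar>f x\<bar> \<le> B"
    and A [measurable]: "A \<in> sets \<mu>" and TA: "T -` A = A" and "0 < N"
  shows "(\<integral>x. indicator A x * birkhoff_avg T N f x \<partial>\<mu>) = (\<integral>x. indicator A x * f x \<partial>\<mu>)"
proof -
  interpret prob_space \<mu> using \<mu> by (simp add: invariant_measures_def)
  have T_A: "T x \<in> A \<longleftrightarrow> x \<in> A" for x using TA by auto
  have T_A': "(T ^^ i) x \<in> A \<longleftrightarrow> x \<in> A" for x i by (induction i) (auto simp: T_A)
  have int: "integrable \<mu> (\<lambda>x. indicator A x * f ((T ^^ i) x))" for i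
    using B by (intro integrable_const_bound[where B=B]) (auto simp: indicator_def order_trans[OF abs_ge_zero B])
  have "(\<integral>x. indicator A x * f ((T ^^ i) x) \<partial>\<mu>) = (\<integral>x. indicator A x * f x \<partial>\<mu>)" for i
    using integral_invariant[OF \<mu> T, of "\<lambda>x. indicator A x * f x" i]
    by (simp add: indicator_def T_A')
  moreover have "(\<integral>x. indicator A x * birkhoff_avg T N f x \<partial>\<mu>)
      = (\<Sum>i<N. \<integral>x. indicator A x * f ((T ^^ i) x) \<partial>\<mu>) / real N"
    unfolding birkhoff_avg_def
    using int by (simp add: sum_distrib_left flip: Bochner_Integration.integral_sum)
  ultimately show ?thesis using \<open>0 < N\<close> by simp
qed

text \<open>On \<open>A\<close> the function may be replaced by any of its Birkhoff averages without
  changing the integral. The deviation from independence is then at most the L1 distance of the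
  average from its mean, hence at most its standard deviation, which can be made arbitrarily
  small.\<close>

lemma (in prob_space) birkhoff_avg_independent:
  fixes f :: "'a \<Rightarrow> real"
  assumes \<mu>: "M \<in> invariant_measures d T" and T [measurable]: "T \<in> measurable M M"
    and f [measurable]: "f \<in> borel_measurable M" and B: "\<And>x. \<bar>f x\<bar> \<le> B"
    and A [measurable]: "A \<in> sets M" and TA: "T -` A = A"
    and small: "\<And>e. 0 < e \<Longrightarrow> \<exists>N>0. expectation (\<lambda>x. (birkhoff_avg T N f x)\<^sup>2) - (expectation f)\<^sup>2 < e"
  shows "expectation (\<lambda>x. indicator A x * f x) = prob A * expectation f"
proof (rule ccontr)
  define c where "c = expectation f"
  assume "\<not> ?thesis"
  then have "0 < \<bar>expectation (\<lambda>x. indicator A x * f x) - prob A * c\<bar>" (is "0 < ?\<delta>")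
    by (simp add: c_def)
  then obtain N where "0 < N"
    and N: "expectation (\<lambda>x. (birkhoff_avg T N f x)\<^sup>2) - c\<^sup>2 < ?\<delta>\<^sup>2"
    using small[of "?\<delta>\<^sup>2"] by (auto simp: c_def)
  let ?g = "birkhoff_avg T N f"
  have g_meas [measurable]: "?g \<in> borel_measurable M" unfolding birkhoff_avg_def by measurable
  have g_bound: "\<bar>?g x\<bar> \<le> B" for x
  proof -
    have "\<bar>\<Sum>i<N. f ((T ^^ i) x)\<bar> \<le> (\<Sum>i<N. B)" by (intro order_trans[OF sum_abs] sum_mono B)
    then show ?thesis using \<open>0 < N\<close> by (simp add: birkhoff_avg_def field_simps)
  qed
  have g2_bound: "(?g x)\<^sup>2 \<le> B\<^sup>2" for x
    using g_bound[of x] by (metis abs_le_square_iff abs_ge_zero abs_of_nonneg order_trans)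
  have "0 \<le> B" using order_trans[OF abs_ge_zero B] .
  have ints: "integrable M ?g" "integrable M (\<lambda>x. indicator A x * ?g x)"
    using g_bound \<open>0 \<le> B\<close> by (auto intro!: integrable_const_bound[where B=B] simp: indicator_def)
  have "integrable M (\<lambda>x. (?g x)\<^sup>2)"
    using g2_bound by (auto intro!: integrable_const_bound[where B="B\<^sup>2"])
  note ints = ints this
  have "integrable M (indicator A :: 'a \<Rightarrow> real)"
    by (intro integrable_const_bound[where B=1]) auto
  note ints = ints this
  have "expectation ?g = c"
    using birkhoff_avg_invariant_set[OF \<mu> T f B sets.top _ \<open>0 < N\<close>]
    by (simp add: c_def space_invariant_measure[OF \<mu>])
  then have var: "expectation (\<lambda>x. (?g x - c)\<^sup>2) = expectation (\<lambda>x. (?g x)\<^sup>2) - c\<^sup>2"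
    using ints by (simp add: power2_diff prob_space) (simp add: power2_eq_square)
  have int_abs: "integrable M (\<lambda>x. \<bar>?g x - c\<bar>)" using ints by auto
  have int_sq: "integrable M (\<lambda>x. (?g x - c)\<^sup>2)" using ints by (simp add: power2_diff)
  have "expectation (\<lambda>x. indicator A x * f x) - prob A * c
      = expectation (\<lambda>x. indicator A x * ?g x) - expectation (\<lambda>x. indicator A x * c)"
    using birkhoff_avg_invariant_set[OF \<mu> T f B A TA \<open>0 < N\<close>] by simp
  also have "\<dots> = expectation (\<lambda>x. indicator A x * (?g x - c))"
    using ints by (subst Bochner_Integration.integral_diff[symmetric]) (auto simp: right_diff_distrib)
  finally have "?\<delta> = \<bar>expectation (\<lambda>x. indicator A x * (?g x - c))\<bar>" by simp
  also have "\<dots> \<le> expectation (\<lambda>x. \<bar>indicator A x * (?g x - c)\<bar>)" by simp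
  also have "\<dots> \<le> expectation (\<lambda>x. \<bar>?g x - c\<bar>)"
  proof (rule integral_mono[OF _ int_abs])
    show "integrable M (\<lambda>x. \<bar>indicator A x * (?g x - c)\<bar>)"
      using ints by (auto simp: right_diff_distrib)
  qed (auto simp: indicator_def)
  finally have "?\<delta>\<^sup>2 \<le> (expectation (\<lambda>x. \<bar>?g x - c\<bar>))\<^sup>2" by (intro power_mono) auto
  \<comment> \<open>Cauchy-Schwarz, read off from the nonnegative variance of the absolute
    deviation.\<close>
  also have "\<dots> \<le> expectation (\<lambda>x. (?g x - c)\<^sup>2)"
  proof -
    have "0 \<le> variance (\<lambda>x. \<bar>?g x - c\<bar>)" by simp
    then show ?thesis using variance_eq[OF int_abs] int_sq by simp
  qed
  finally show False using N var by simp
qed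

text \<open>Approximation by \<open>\<C>\<close> and dominated convergence turn independence from
  functions into independence from the sets of a pi-system. This extends to the generated
  sigma-algebra, so an invariant set can be tested against itself and its probability solves
  \<open>p = p * p\<close>.\<close>

lemma ergodicI:
  assumes \<mu>: "\<mu> \<in> invariant_measures d T" and T [measurable]: "T \<in> measurable \<mu> \<mu>"
    and stable: "Int_stable \<P>" and gen: "sets \<mu> = sigma_sets UNIV \<P>"
    and approx: "\<And>P. P \<in> \<P> \<Longrightarrow> \<exists>f. \<forall>k::nat. f k \<in> \<C> \<and> (\<forall>x. \<bar>f k x\<bar> \<le> (1::real)) \<and> (\<forall>x. (\<lambda>k. f k x) \<longlonglongrightarrow> indicator P x)"
    and meas: "\<And>f. f \<in> \<C> \<Longrightarrow> f \<in> borel_measurable \<mu>"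
    and small: "\<And>f e. f \<in> \<C> \<Longrightarrow> 0 < e \<Longrightarrow>
       \<exists>N>0. (\<integral>x. (birkhoff_avg T N f x)\<^sup>2 \<partial>\<mu>) - (\<integral>x. f x \<partial>\<mu>)\<^sup>2 < e"
  shows "\<mu> \<in> ergodic_measures d T"
proof -
  interpret prob_space \<mu> using \<mu> by (simp add: invariant_measures_def)
  have sp: "space \<mu> = UNIV" by (rule space_invariant_measure[OF \<mu>])
  have "emeasure \<mu> A = 0 \<or> emeasure \<mu> A = 1" if A [measurable]: "A \<in> sets \<mu>" and TA: "T -` A = A" for A
  proof -
    have "prob (A \<inter> P) = prob A * prob P" if P\<P>: "P \<in> \<P>" for P
    proof -
      have P [measurable]: "P \<in> sets \<mu>" using P\<P> gen by auto
      obtain f where f: "\<And>k. f k \<in> \<C>" "\<And>k x. \<bar>f k x\<bar> \<le> (1::real)"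
        "\<And>x. (\<lambda>k. f k x) \<longlonglongrightarrow> indicator P x" using approx[OF P\<P>] by metis
      have [measurable]: "f k \<in> borel_measurable \<mu>" for k by (intro meas f)
      have eq: "expectation (\<lambda>x. indicator A x * f k x) = prob A * expectation (f k)" for k
        by (rule birkhoff_avg_independent[OF \<mu> T _ f(2) A TA]) (use small[OF f(1)] in auto)
      have "(\<lambda>k. expectation (\<lambda>x. indicator A x * f k x)) \<longlonglongrightarrow> expectation (\<lambda>x. indicator A x * indicator P x)"
        using f(2) by (intro integral_dominated_convergence[where w="\<lambda>_. 1"] AE_I2 tendsto_mult tendsto_const f(3))
          (auto simp: indicator_def)
      moreover have "(\<lambda>k. prob A * expectation (f k)) \<longlonglongrightarrow> prob A * expectation (indicator P)"
        using f(2) by (intro tendsto_mult tendsto_const integral_dominated_convergence[where w="\<lambda>_. 1"] AE_I2 f(3)) auto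
      ultimately have "expectation (\<lambda>x. indicator A x * indicator P x) = prob A * expectation (indicator P)"
        unfolding eq by (rule LIMSEQ_unique)
      then show ?thesis by (simp add: sp flip: indicator_inter_arith)
    qed
    then have "indep_set {A} \<P>"
      using gen by (auto simp: indep_sets2_eq)
    then have "indep_set (sigma_sets (space \<mu>) {A}) (sigma_sets (space \<mu>) \<P>)"
      by (rule indep_set_sigma_sets) (use stable in \<open>auto simp: Int_stable_def\<close>)
    then have "prob (A \<inter> A) = prob A * prob A"
      by (rule indep_setD) (use A gen sp in auto)
    then have "prob A = 0 \<or> prob A = 1" by (simp add: mult_cancel_right1)
    then show ?thesis by (auto simp: emeasure_eq_measure)
  qed
  then show ?thesis using \<mu> by (auto simp: ergodic_measures_def)
qed

text \<open>Finite intersections of balls with centres in \<open>D\<close> and radii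
  \<open>1 / real (Suc n)\<close> form the pi-system. They are indexed by lists: appending gives the
  intersection, and the empty list gives the whole space. The continuous function \<open>h L\<close>
  is positive exactly on the intersection, so \<open>min 1 (real k * h L x)\<close> converges to its
  indicator.\<close>

lemma countable_determining_family:
  assumes d: "Metric_space UNIV d" and "countable D" and dense: "\<And>x \<epsilon>. 0 < \<epsilon> \<Longrightarrow> \<exists>y\<in>D. d y x < \<epsilon>"
  obtains \<C> \<P> where "countable \<C>" "\<C> \<subseteq> bounded_continuous d" "Int_stable \<P>"
    "sets (borel_metric d) = sigma_sets UNIV \<P>"
    "\<And>P. P \<in> \<P> \<Longrightarrow> \<exists>f. \<forall>k::nat. f k \<in> \<C> \<and> (\<forall>x. \<bar>f k x\<bar> \<le> (1::real)) \<and> (\<forall>x. (\<lambda>k. f k x) \<longlonglongrightarrow> indicator P x)"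
proof -
  interpret Metric_space UNIV d by fact
  define b where "b = (\<lambda>(y, n). mball y (1 / real (Suc n)))"
  define h where "h L x = prod_list (map (\<lambda>(y, n). max 0 (1 / real (Suc n) - d y x)) L)" for L and x
  define \<P> where "\<P> = (\<lambda>L. \<Inter>p\<in>set L. b p) ` lists (D \<times> UNIV)"
  define F where "F k L x = min 1 (real k * h L x)" for k :: nat and L x
  define \<C> where "\<C> = (\<lambda>(k, L). F k L) ` (UNIV \<times> lists (D \<times> UNIV))"
  have h0: "0 \<le> h L x" for L x unfolding h_def by (induction L) auto
  have h_pos: "0 < h L x \<longleftrightarrow> x \<in> (\<Inter>p\<in>set L. b p)" for L x
  proof (induction L)
    case (Cons p L)
    have "0 < h (p # L) x \<longleftrightarrow> 0 < (case p of (y, n) \<Rightarrow> max 0 (1 / real (Suc n) - d y x)) \<and> 0 < h L x"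
      using h0[of L x] by (auto simp: h_def zero_less_mult_iff split: prod.split)
    then show ?case using Cons by (auto simp: b_def split: prod.split)
  qed (simp add: h_def)
  have h_cont: "continuous_map mtopology euclideanreal (h L)" for L
    unfolding h_def
  proof (induction L)
    case (Cons p L)
    then show ?case
      by (cases p) (auto intro!: continuous_intros continuous_map_dist_from d)
  qed simp
  have F_bound: "\<bar>F k L x\<bar> \<le> 1" for k L x using mult_nonneg_nonneg[OF of_nat_0_le_iff h0, of k L x] by (auto simp: F_def min_def)
  have "F k L \<in> bounded_continuous d" for k L
    by (rule bounded_continuousI[of _ _ 1])
      (use F_bound h_cont in \<open>auto simp: F_def[abs_def] intro!: continuous_intros\<close>)
  then have "\<C> \<subseteq> bounded_continuous d" by (auto simp: \<C>_def)
  moreover have "countable \<C>"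
    unfolding \<C>_def using \<open>countable D\<close> by (intro countable_image countable_SIGMA countable_lists) auto
  moreover have "Int_stable \<P>"
  proof (rule Int_stableI)
    fix P Q assume "P \<in> \<P>" "Q \<in> \<P>"
    then obtain L L' where "L \<in> lists (D \<times> UNIV)" "L' \<in> lists (D \<times> UNIV)"
      "P = (\<Inter>p\<in>set L. b p)" "Q = (\<Inter>p\<in>set L'. b p)" by (auto simp: \<P>_def)
    then show "P \<inter> Q \<in> \<P>"
      unfolding \<P>_def by (intro image_eqI[of _ _ "L @ L'"]) auto
  qed
  moreover have "sets (borel_metric d) = sigma_sets UNIV \<P>"
  proof -
    have "sigma_sets UNIV {U. openin mtopology U} = sigma_sets UNIV \<P>"
    proof (rule sigma_sets_eqI)
      fix U assume U: "U \<in> {U. openin mtopology U}"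
      define I where "I = {p \<in> D \<times> UNIV. b p \<subseteq> U}"
      have "U = (\<Union>p\<in>I. b p)"
      proof
        show "U \<subseteq> (\<Union>p\<in>I. b p)"
        proof
          fix x assume "x \<in> U"
          then obtain r where r: "0 < r" "mball x r \<subseteq> U"
            using U by (auto simp: openin_mtopology)
          then obtain n where n: "1 / real (Suc n) < r / 2"
            using nat_approx_posE[of "r / 2"] by auto
          obtain y where y: "y \<in> D" "d y x < 1 / real (Suc n)"
            using dense[of "1 / real (Suc n)" x] by auto
          have "b (y, n) \<subseteq> mball x r"
          proof
            fix z assume "z \<in> b (y, n)"
            then have "d y z < 1 / real (Suc n)" by (simp add: b_def)
            then show "z \<in> mball x r" using y n triangle[of x y z] commute[of x y] by simp
          qed
          then show "x \<in> (\<Union>p\<in>I. b p)"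
            using r y by (intro UN_I[of "(y, n)"]) (auto simp: I_def b_def)
        qed
      qed (auto simp: I_def)
      moreover have "countable I"
        using \<open>countable D\<close> by (auto simp: I_def intro: countable_subset[OF _ countable_SIGMA])
      moreover have "b p \<in> sigma_sets UNIV \<P>" if "p \<in> I" for p
        using that by (intro sigma_sets.Basic) (auto simp: \<P>_def I_def intro!: image_eqI[of _ _ "[p]"])
      ultimately show "U \<in> sigma_sets UNIV \<P>"
        by (auto intro!: sigma_sets_UNION)
    next
      fix P assume "P \<in> \<P>"
      then obtain L where L: "P = (\<Inter>p\<in>set L. b p)" by (auto simp: \<P>_def)
      have "openin mtopology (\<Inter>p\<in>set L. b p)"
      proof (induction L)
        case Nil
        show ?case using openin_topspace[of mtopology] by simp
      qed (auto simp: b_def split: prod.split)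
      then show "P \<in> sigma_sets UNIV {U. openin mtopology U}"
        by (auto simp: L intro!: sigma_sets.Basic)
    qed
    then show ?thesis by (simp add: sets_borel_metric)
  qed
  moreover have "\<exists>f. \<forall>k::nat. f k \<in> \<C> \<and> (\<forall>x. \<bar>f k x\<bar> \<le> (1::real)) \<and> (\<forall>x. (\<lambda>k. f k x) \<longlonglongrightarrow> indicator P x)"
    if "P \<in> \<P>" for P
  proof -
    obtain L where L: "L \<in> lists (D \<times> UNIV)" "P = (\<Inter>p\<in>set L. b p)" using \<open>P \<in> \<P>\<close> by (auto simp: \<P>_def)
    have "(\<lambda>k. F k L x) \<longlonglongrightarrow> indicator P x" for x
    proof (cases "x \<in> P")
      case True
      then have "0 < h L x" using h_pos L by auto
      then obtain m :: nat where m: "1 / h L x < real m" using reals_Archimedean2 by blast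
      have "F k L x = 1" if "k \<ge> m" for k
      proof -
        have "1 / h L x \<le> real k" using m that by linarith
        then show ?thesis using \<open>0 < h L x\<close> by (simp add: F_def field_simps)
      qed
      then have "\<forall>\<^sub>F k in sequentially. F k L x = 1" by (auto simp: eventually_sequentially)
      then show ?thesis using True by (simp add: tendsto_eventually)
    next
      case False
      then have "h L x = 0" using h_pos[of L x] h0[of L x] L by (metis order_le_less)
      then show ?thesis using False by (simp add: F_def)
    qed
    then show ?thesis
      using L F_bound by (intro exI[of _ "\<lambda>k. F k L"]) (auto simp: \<C>_def)
  qed
  ultimately show thesis using that by blast
qed

section \<open>The metric of the full shift\<close>

text \<open>Compactness yields finite nets and uniform continuity; the class
  \<open>perfect_space\<close> yields, near each letter, a different one; monotonicity bounds the
  weights of a window from below; \<open>growth\<close> compares these weights with powers of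
  2.\<close>

locale compact_full_shift =
  fixes a :: "nat \<Rightarrow> real" and d :: "(int \<Rightarrow> 'a::{metric_space, perfect_space}) \<Rightarrow> (int \<Rightarrow> 'a) \<Rightarrow> real"
  assumes compact_alphabet: "compact (UNIV :: 'a set)"
    and mono_a: "mono a" and a_nonneg: "\<And>n. 0 \<le> a n"
    and summable_a: "summable (\<lambda>k. 1 / (a k + 1))"
    and growth: "\<And>\<alpha>::real. \<alpha> > 0 \<Longrightarrow> (\<lambda>k. a k / exp (\<alpha> * real k)) \<longlonglongrightarrow> 0"
  defines "d \<equiv> shift_dist a"
begin

section \<open>Product topology, compactness and uniform continuity\<close>

definition weight :: "int \<Rightarrow> real" where "weight n = 1 / (a (nat \<bar>n\<bar>) + 1)"

lemma d_eq: "d x y = (\<Sum>\<^sub>\<infinity>n\<in>UNIV. min (weight n) (dist (x n) (y n)))"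
  by (simp add: d_def shift_dist_def weight_def)

lemma weight_pos: "0 < weight n"
  using a_nonneg[of "nat \<bar>n\<bar>"] by (simp add: weight_def)

lemma summable_d: "(\<lambda>n. min (weight n) (dist (x n) (y n :: 'a))) summable_on UNIV"
  unfolding weight_def by (rule summable_on_shift_dist[OF a_nonneg summable_a])

lemma summable_weight: "weight summable_on UNIV"
proof -
  have *: "(\<lambda>n. 1 / (a n + 1)) summable_on UNIV"
    using a_nonneg summable_a by (intro summable_nonneg_imp_summable_on) (auto simp: add_nonneg_nonneg)
  have "weight summable_on range int"
    unfolding weight_def[abs_def]
    by (subst summable_on_reindex) (use * in \<open>auto simp: o_def inj_on_def\<close>)
  moreover have "weight summable_on range (\<lambda>n. - int n)"
    unfolding weight_def[abs_def]
    by (subst summable_on_reindex) (use * in \<open>auto simp: o_def inj_on_def\<close>)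
  ultimately have "weight summable_on (range int \<union> range (\<lambda>n. - int n))"
    by (rule summable_on_union)
  moreover have "range int \<union> range (\<lambda>n. - int n) = UNIV"
    by (auto simp: image_iff) (metis int_cases2)
  ultimately show ?thesis by simp
qed

sublocale Metric_space UNIV d
  unfolding d_def by (rule Metric_space_shift_dist[OF a_nonneg summable_a])

lemma Metric_space_d: "Metric_space UNIV d" ..

lemma coordinate_le_d: "min (weight n) (dist (x n) (y n)) \<le> d x y"
proof -
  have "(\<Sum>n\<in>{n}. min (weight n) (dist (x n) (y n))) \<le> d x y"
    unfolding d_eq by (intro finite_sum_le_infsum summable_d)
      (auto simp: less_imp_le[OF weight_pos])
  then show ?thesis by simp
qed

text \<open>Off a finite set \<open>F\<close> of coordinates the weights alone bound the sum by
  \<open>r / 3\<close>, whatever the points are; \<delta> shares another \<open>r / 3\<close> among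
  the coordinates of \<open>F\<close>.\<close>

lemma d_small:
  assumes "0 < r"
  shows "\<exists>m \<delta>. 0 < \<delta> \<and> (\<forall>x y. (\<forall>n. \<bar>n\<bar> \<le> int m \<longrightarrow> dist (x n) (y n) < \<delta>) \<longrightarrow> d x y < r)"
proof -
  obtain F where F: "finite F" "dist (sum weight F) (infsum weight UNIV) \<le> r / 3"
    using infsum_finite_approximation[OF summable_weight, of "r / 3"] \<open>0 < r\<close> by auto
  have sm: "weight summable_on (- F)" using summable_on_subset[OF summable_weight] by auto
  have "infsum weight UNIV = infsum weight (F \<union> - F)" by simp
  also have "\<dots> = infsum weight F + infsum weight (- F)"
    using F sm by (intro infsum_Un_disjoint) auto
  finally have tail: "infsum weight (- F) \<le> r / 3"
    using F by (simp add: dist_real_def)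
  define \<delta> where "\<delta> = r / (3 * (real (card F) + 1))"
  have "0 < \<delta>" using \<open>0 < r\<close> by (simp add: \<delta>_def)
  have \<delta>: "real (card F) * \<delta> \<le> r / 3"
    using \<open>0 < r\<close> by (simp add: \<delta>_def field_simps)
  obtain m where m: "\<And>n. n \<in> F \<Longrightarrow> nat \<bar>n\<bar> \<le> m"
    using finite_nat_set_iff_bounded_le[of "(\<lambda>n. nat \<bar>n\<bar>) ` F"] F(1) by auto
  show ?thesis
  proof (intro exI conjI allI impI)
    fix x y :: "int \<Rightarrow> 'a" assume close: "\<forall>n. \<bar>n\<bar> \<le> int m \<longrightarrow> dist (x n) (y n) < \<delta>"
    have sF: "(\<lambda>n. min (weight n) (dist (x n) (y n))) summable_on - F"
      using summable_on_subset[OF summable_d] by auto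
    have "d x y = infsum (\<lambda>n. min (weight n) (dist (x n) (y n))) (F \<union> - F)"
      by (simp add: d_eq)
    also have "\<dots> = infsum (\<lambda>n. min (weight n) (dist (x n) (y n))) F
        + infsum (\<lambda>n. min (weight n) (dist (x n) (y n))) (- F)"
      using F(1) sF by (intro infsum_Un_disjoint) auto
    also have "\<dots> \<le> real (card F) * \<delta> + infsum weight (- F)"
    proof (rule add_mono)
      have "(\<Sum>n\<in>F. min (weight n) (dist (x n) (y n))) \<le> (\<Sum>n\<in>F. \<delta>)"
        using close m by (intro sum_mono) (force simp: min_le_iff_disj less_imp_le)
      then show "infsum (\<lambda>n. min (weight n) (dist (x n) (y n))) F \<le> real (card F) * \<delta>"
        using F(1) by simp
    qed (intro infsum_mono sm sF, simp)
    also have "\<dots> < r" using \<delta> tail \<open>0 < r\<close> by linarith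
    finally show "d x y < r" .
  qed fact
qed

text \<open>One inclusion comes from \<open>d_small\<close>, the other from
  \<open>coordinate_le_d\<close>. On the function type \<open>euclidean\<close> is the product
  topology, so compactness follows from Tychonoff's theorem and continuity of the shift can be
  checked coordinatewise.\<close>

lemma mtopology_eq_euclidean: "mtopology = euclidean"
  unfolding topology_eq
proof (intro allI iffI)
  fix U :: "(int \<Rightarrow> 'a) set"
  assume U: "openin mtopology U"
  have "\<exists>V. open V \<and> x \<in> V \<and> V \<subseteq> U" if xU: "x \<in> U" for x
  proof -
    obtain r where r: "0 < r" "mball x r \<subseteq> U" using U xU unfolding openin_mtopology by blast
    obtain m \<delta> where m: "0 < \<delta>"
      "\<And>x y. (\<forall>n. \<bar>n\<bar> \<le> int m \<longrightarrow> dist (x n) (y n) < \<delta>) \<Longrightarrow> d x y < r"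
      using d_small[OF r(1)] by blast
    define V where "V = (\<Pi>\<^sub>E n\<in>UNIV. if \<bar>n\<bar> \<le> int m then ball (x n) \<delta> else UNIV)"
    have "{n. \<bar>n\<bar> \<le> int m} = {- int m..int m}" by auto
    then have fin: "finite {n. \<bar>n\<bar> \<le> int m}" by simp
    have "open V"
      unfolding V_def by (rule open_PiE) (auto intro: finite_subset[OF _ fin])
    moreover have "x \<in> V" using m(1) by (auto simp: V_def)
    moreover have "V \<subseteq> U"
    proof
      fix y assume "y \<in> V"
      then have "dist (x n) (y n) < \<delta>" if "\<bar>n\<bar> \<le> int m" for n
        using PiE_mem[OF \<open>y \<in> V\<close>[unfolded V_def], of n] that by simp
      then have "y \<in> mball x r" using m(2) by simp
      then show "y \<in> U" using r(2) by blast
    qed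
    ultimately show ?thesis by blast
  qed
  then show "openin euclidean U" by (subst open_openin[symmetric], subst open_subopen) blast
next
  fix U :: "(int \<Rightarrow> 'a) set"
  assume "openin euclidean U"
  then have U: "openin (product_topology (\<lambda>i::int. euclidean :: 'a topology) UNIV) U"
    by (simp add: euclidean_product_topology)
  have "\<exists>r>0. mball x r \<subseteq> U" if "x \<in> U" for x
  proof -
    from product_topology_open_contains_basis[OF U that]
    obtain X where X: "x \<in> PiE UNIV X" "\<And>i. open (X i)" "finite {i. X i \<noteq> UNIV}" "PiE UNIV X \<subseteq> U"
      by auto
    have "\<exists>e>0. ball (x i) e \<subseteq> X i" for i
      using X(1,2) by (auto simp: PiE_iff open_contains_ball)
    then obtain e where e: "\<And>i. 0 < e i" "\<And>i. ball (x i) (e i) \<subseteq> X i" by metis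
    \<comment> \<open>If \<open>d x y < r\<close>, the minimum in \<open>coordinate_le_d\<close> is
      below \<open>weight i\<close>, so it is the distance, which is then below \<open>e i\<close>.
      The element 1 covers the case of no constrained coordinate.\<close>
    define r where "r = Min (insert 1 ((\<lambda>i. min (weight i) (e i)) ` {i. X i \<noteq> UNIV}))"
    have "0 < r" using X(3) e(1) weight_pos by (auto simp: r_def)
    moreover have "mball x r \<subseteq> U"
    proof
      fix y assume "y \<in> mball x r"
      then have y: "d x y < r" by simp
      have "y i \<in> X i" for i
      proof (cases "X i = UNIV")
        case False
        then have "r \<le> min (weight i) (e i)" unfolding r_def using X(3) by (intro Min_le) auto
        then have "dist (x i) (y i) < e i"
          using y coordinate_le_d[of i x y] by linarith
        then show ?thesis using e(2)[of i] by auto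
      qed simp
      then show "y \<in> U" using X(4) by auto
    qed
    ultimately show ?thesis by blast
  qed
  then show "openin mtopology U" by (auto simp: openin_mtopology)
qed

lemma compact_space_mtopology: "compact_space mtopology"
proof -
  have "compact_space (euclidean :: 'a topology)"
    using compact_alphabet by (simp add: compact_space_def)
  then have "compact_space (product_topology (\<lambda>i::int. euclidean :: 'a topology) UNIV)"
    by (simp add: compact_space_product_topology)
  then show ?thesis by (simp add: mtopology_eq_euclidean euclidean_product_topology)
qed

lemma finite_net:
  assumes "0 < \<epsilon>"
  obtains Y where "finite Y" "\<And>x. \<exists>y\<in>Y. d y x < \<epsilon>"
proof -
  have "mtotally_bounded UNIV"
    using compact_space_mtopology compact_space_eq_mcomplete_mtotally_bounded by blast
  then obtain Y where "finite Y" "UNIV \<subseteq> (\<Union>y\<in>Y. mball y \<epsilon>)"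
    using assms unfolding mtotally_bounded_def by blast
  then have "\<forall>x. \<exists>y\<in>Y. x \<in> mball y \<epsilon>" by blast
  then show thesis using \<open>finite Y\<close> by (intro that[of Y]) auto
qed

text \<open>Compactness makes \<open>f\<close> uniformly continuous for \<open>d\<close>, and
  \<open>d_small\<close> converts closeness in \<open>d\<close> into closeness on a finite window.
  In this form orbits can be compared word by word.\<close>

lemma bounded_continuous_uniform:
  assumes "f \<in> bounded_continuous d" and "0 < \<epsilon>"
  shows "\<exists>m \<delta>. 0 < \<delta> \<and> (\<forall>x y. (\<forall>n. \<bar>n\<bar> \<le> int m \<longrightarrow> dist (x n) (y n) < \<delta>) \<longrightarrow> \<bar>f x - f y\<bar> < \<epsilon>)"
proof -
  have "continuous_map (mtopology_of (metric (UNIV, d))) (mtopology_of euclidean_metric) f"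
    using assms(1) by (simp add: bounded_continuous_def)
  then have "uniformly_continuous_map (metric (UNIV, d)) euclidean_metric f"
    using compact_space_mtopology by (intro continuous_imp_uniformly_continuous_map) auto
  then obtain r where "0 < r" and r: "\<And>x y. d y x < r \<Longrightarrow> dist (f y) (f x) < \<epsilon>"
    using \<open>0 < \<epsilon>\<close> unfolding uniformly_continuous_map_def by fastforce
  obtain m \<delta> where "0 < \<delta>" and m: "\<And>x y. (\<forall>n. \<bar>n\<bar> \<le> int m \<longrightarrow> dist (x n) (y n) < \<delta>) \<Longrightarrow> d x y < r"
    using d_small[OF \<open>0 < r\<close>] by blast
  show ?thesis
  proof (intro exI conjI allI impI)
    fix x y :: "int \<Rightarrow> 'a" assume "\<forall>n. \<bar>n\<bar> \<le> int m \<longrightarrow> dist (x n) (y n) < \<delta>"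
    from r[of y x] m[OF this] show "\<bar>f x - f y\<bar> < \<epsilon>" by (simp add: dist_real_def commute)
  qed fact
qed

lemma bounded_continuous_uniform_finite:
  assumes "finite F" "F \<subseteq> bounded_continuous d" and "0 < \<epsilon>"
  shows "\<exists>m \<delta>. 0 < \<delta> \<and> (\<forall>f\<in>F. \<forall>x y. (\<forall>n. \<bar>n\<bar> \<le> int m \<longrightarrow> dist (x n) (y n) < \<delta>) \<longrightarrow> \<bar>f x - f y\<bar> < \<epsilon>)"
  using assms(1,2)
proof (induction F)
  case empty
  show ?case by (auto intro: exI[of _ 1])
next
  case (insert g F)
  then obtain m \<delta> where 1: "0 < \<delta>"
    "\<And>f x y. f \<in> F \<Longrightarrow> (\<forall>n. \<bar>n\<bar> \<le> int m \<longrightarrow> dist (x n) (y n) < \<delta>) \<Longrightarrow> \<bar>f x - f y\<bar> < \<epsilon>" by blast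
  obtain m' \<delta>' where 2: "0 < \<delta>'"
    "\<And>x y. (\<forall>n. \<bar>n\<bar> \<le> int m' \<longrightarrow> dist (x n) (y n) < \<delta>') \<Longrightarrow> \<bar>g x - g y\<bar> < \<epsilon>"
    using bounded_continuous_uniform[of g \<epsilon>] insert.prems \<open>0 < \<epsilon>\<close> by blast
  show ?case
  proof (intro exI conjI ballI allI impI)
    show "0 < min \<delta> \<delta>'" using 1 2 by simp
    fix f and x y :: "int \<Rightarrow> 'a" assume "f \<in> insert g F"
      and "\<forall>n. \<bar>n\<bar> \<le> int (max m m') \<longrightarrow> dist (x n) (y n) < min \<delta> \<delta>'"
    then show "\<bar>f x - f y\<bar> < \<epsilon>" using 1(2)[of f x y] 2(2)[of x y] by auto
  qed
qed

section \<open>Continuity and measurability of the shift\<close>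

lemma shift_pow: "(full_shift ^^ i) x n = x (n - int i)" for x :: "int \<Rightarrow> 'a"
  by (induction i arbitrary: n) (auto simp: full_shift_def algebra_simps)

lemma continuous_shift_pow: "continuous_map mtopology mtopology (full_shift ^^ i :: (int \<Rightarrow> 'a) \<Rightarrow> _)"
proof -
  have "continuous_on UNIV (\<lambda>x::int \<Rightarrow> 'a. x (n - int i))" for n
    by (rule continuous_on_product_coordinates)
  then have "continuous_on UNIV (full_shift ^^ i :: (int \<Rightarrow> 'a) \<Rightarrow> _)"
    by (intro continuous_on_coordinatewise_then_product) (simp add: shift_pow)
  then show ?thesis by (simp add: mtopology_eq_euclidean)
qed

lemma borel_metric_d: "sets (borel_metric d) = sets borel"
  by (simp add: sets_borel_metric mtopology_eq_euclidean sets_borel)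

lemma measurable_shift:
  assumes "sets \<mu> = sets (borel_metric d)"
  shows "full_shift \<in> measurable \<mu> \<mu>"
proof -
  have "continuous_on UNIV (full_shift :: (int \<Rightarrow> 'a) \<Rightarrow> _)"
    using continuous_shift_pow[of 1] by (simp add: mtopology_eq_euclidean)
  then have "full_shift \<in> measurable (borel :: (int \<Rightarrow> 'a) measure) borel"
    by (rule borel_measurable_continuous_onI)
  then show ?thesis using assms borel_metric_d by (simp cong: measurable_cong_sets)
qed

lemma bounded_continuous_birkhoff_avg:
  assumes "f \<in> bounded_continuous d"
  shows "birkhoff_avg full_shift N f \<in> bounded_continuous d"
proof -
  obtain B where B: "\<And>x. \<bar>f x\<bar> \<le> B" using bounded_continuousE[OF assms] by blast
  have "continuous_map mtopology euclideanreal (f \<circ> (full_shift ^^ i))" for i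
    using assms by (intro continuous_map_compose[OF continuous_shift_pow]) (simp add: bounded_continuous_def)
  then have *: "continuous_map mtopology euclideanreal (\<lambda>x. f ((full_shift ^^ i) x))" for i
    by (simp add: o_def)
  show ?thesis
  proof (rule bounded_continuousI)
    show "continuous_map mtopology euclideanreal (birkhoff_avg full_shift N f)"
      unfolding birkhoff_avg_def[abs_def] divide_inverse by (intro continuous_intros *) auto
    fix x
    have "\<bar>\<Sum>i<N. f ((full_shift ^^ i) x)\<bar> \<le> (\<Sum>i<N. B)" by (intro order_trans[OF sum_abs] sum_mono B)
    then show "\<bar>birkhoff_avg full_shift N f x\<bar> \<le> B"
      using order_trans[OF abs_ge_zero B] by (cases "N = 0") (auto simp: birkhoff_avg_def field_simps)
  qed
qed

end

section \<open>Periodic orbit measures\<close>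

text \<open>The image of the uniform distribution on times: points visited repeatedly within
  \<open>P\<close> steps count with multiplicity, so periods other than the minimal one give the
  same measure.\<close>

definition orbit_measure :: "'b measure \<Rightarrow> ('b \<Rightarrow> 'b) \<Rightarrow> nat \<Rightarrow> 'b \<Rightarrow> 'b measure" where
  "orbit_measure M T P z = distr (uniform_count_measure {..<P}) M (\<lambda>i. (T ^^ i) z)"

lemma sets_orbit_measure [simp]: "sets (orbit_measure M T P z) = sets M"
  and space_orbit_measure [simp]: "space (orbit_measure M T P z) = space M"
  by (simp_all add: orbit_measure_def)

lemma prob_space_orbit_measure:
  assumes "0 < P" "space M = UNIV"
  shows "prob_space (orbit_measure M T P z)"
  unfolding orbit_measure_def using assms
  by (intro prob_space.prob_space_distr prob_space_uniform_count_measure)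
     (auto simp: measurable_def space_uniform_count_measure sets_uniform_count_measure)

lemma measure_orbit_measure:
  assumes "0 < P" "space M = UNIV" "A \<in> sets M"
  shows "measure (orbit_measure M T P z) A = real (card {i. i < P \<and> (T ^^ i) z \<in> A}) / real P"
proof -
  have "measure (orbit_measure M T P z) A = measure (uniform_count_measure {..<P}) ((\<lambda>i. (T ^^ i) z) -` A \<inter> {..<P})"
    unfolding orbit_measure_def using assms
    by (subst measure_distr) (auto simp: measurable_def space_uniform_count_measure sets_uniform_count_measure)
  also have "\<dots> = real (card ((\<lambda>i. (T ^^ i) z) -` A \<inter> {..<P})) / real P"
    by (subst measure_uniform_count_measure) auto
  also have "(\<lambda>i. (T ^^ i) z) -` A \<inter> {..<P} = {i. i < P \<and> (T ^^ i) z \<in> A}" by auto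
  finally show ?thesis .
qed

lemma integral_orbit_measure:
  assumes "0 < P" "space M = UNIV" "f \<in> borel_measurable M"
  shows "(\<integral>x. f x \<partial>orbit_measure M T P z) = birkhoff_avg T P f z"
proof -
  have "(\<integral>x. f x \<partial>orbit_measure M T P z) = (\<integral>i. f ((T ^^ i) z) \<partial>uniform_count_measure {..<P})"
    unfolding orbit_measure_def using assms
    by (intro integral_distr) (auto simp: measurable_def space_uniform_count_measure sets_uniform_count_measure)
  also have "\<dots> = birkhoff_avg T P f z"
    using assms(1)
    by (simp add: uniform_count_measure_def lebesgue_integral_point_measure_finite birkhoff_avg_def
        sum_divide_distrib)
  finally show ?thesis .
qed

text \<open>Starting one step later drops the first term and adds an equal one at the end. Hence the
  average over a period is constant on the orbit and has variance 0 for the orbit measure.\<close>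

lemma birkhoff_avg_periodic:
  assumes "(T ^^ P) z = z"
  shows "birkhoff_avg T P f ((T ^^ i) z) = birkhoff_avg T P f z"
proof (induction i)
  case (Suc i)
  let ?y = "(T ^^ i) z"
  have per: "(T ^^ P) ?y = ?y" using assms by (metis comp_apply funpow_add add.commute)
  have "(\<Sum>j<P. f ((T ^^ j) (T ?y))) = (\<Sum>j<P. f ((T ^^ Suc j) ?y))" by (simp add: funpow_swap1)
  also have "\<dots> = (\<Sum>j<Suc P. f ((T ^^ j) ?y)) - f ?y"
    unfolding sum.lessThan_Suc_shift by simp
  also have "\<dots> = (\<Sum>j<P. f ((T ^^ j) ?y))" using per by simp
  finally show ?case using Suc by (simp add: birkhoff_avg_def)
qed simp

lemma funpow_mult_periodic: "(T ^^ P) z = z \<Longrightarrow> (T ^^ (P * l)) z = z"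
  by (induction l) (auto simp: funpow_add)

lemma sum_blocks:
  fixes h :: "nat \<Rightarrow> real"
  shows "(\<Sum>k<N * p. h k) = (\<Sum>j<N. \<Sum>i<p. h (j * p + i))"
proof -
  have "sum h {j * p..<j * p + p} = (\<Sum>i<p. h (j * p + i))" for j
    using sum.shift_bounds_nat_ivl[of h 0 "j * p" p] by (simp add: add.commute atLeast0LessThan)
  then show ?thesis by (simp flip: sum.nat_group)
qed

text \<open>Serves to compare a periodic point with a perturbation of longer period: both averages
  can be taken over the longer one.\<close>

lemma birkhoff_avg_mult:
  assumes "(T ^^ P) z = z" "0 < P" "0 < l"
  shows "birkhoff_avg T (P * l) f z = birkhoff_avg T P f z"
proof -
  have "(T ^^ (j * P + i)) z = (T ^^ i) z" for i j
    using funpow_mult_periodic[OF assms(1), of j] by (simp add: funpow_add add.commute mult.commute)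
  then have "(\<Sum>k<l * P. f ((T ^^ k) z)) = real l * (\<Sum>i<P. f ((T ^^ i) z))"
    by (simp add: sum_blocks)
  then show ?thesis using assms by (simp add: birkhoff_avg_def mult.commute)
qed

text \<open>The mass of a set is the Birkhoff average of its indicator at \<open>z\<close>; taking
  the preimage moves the starting point to \<open>T z\<close>, which changes nothing over a
  period.\<close>

lemma orbit_measure_invariant:
  assumes "0 < P" "(T ^^ P) z = z" and T: "T \<in> measurable (borel_metric d) (borel_metric d)"
  shows "orbit_measure (borel_metric d) T P z \<in> invariant_measures d T"
proof -
  let ?\<nu> = "orbit_measure (borel_metric d) T P z"
  have sp: "space (borel_metric d) = UNIV" by (simp add: borel_metric_def)
  interpret prob_space ?\<nu> by (rule prob_space_orbit_measure[OF assms(1) sp])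
  have "emeasure ?\<nu> (T -` A) = emeasure ?\<nu> A" if A: "A \<in> sets (borel_metric d)" for A
  proof -
    have TA: "T -` A \<in> sets (borel_metric d)"
      using measurable_sets[OF T A] by (simp add: sp)
    have eq: "measure ?\<nu> B = birkhoff_avg T P (indicator B) z" if "B \<in> sets (borel_metric d)" for B
      using that integral_orbit_measure[OF assms(1) sp, of "indicator B"] by (simp add: sp)
    have "measure ?\<nu> (T -` A) = birkhoff_avg T P (\<lambda>x. indicator A (T x)) z"
      using eq[OF TA] by (simp add: birkhoff_avg_def indicator_def)
    also have "\<dots> = birkhoff_avg T P (indicator A) ((T ^^ 1) z)"
      by (simp add: birkhoff_avg_def funpow_swap1)
    also have "\<dots> = measure ?\<nu> A"
      unfolding birkhoff_avg_periodic[OF assms(2)] eq[OF A] ..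
    finally show ?thesis by (simp add: emeasure_eq_measure)
  qed
  then show ?thesis by (simp add: invariant_measures_def prob_space_axioms)
qed

context compact_full_shift
begin

section \<open>Density of periodic measures\<close>

lemma bounded_continuous_abs_bound_finite:
  assumes "finite F" "F \<subseteq> bounded_continuous d"
  shows "\<exists>B>0. \<forall>f\<in>F. \<forall>x. \<bar>f x\<bar> \<le> B"
  using assms
proof (induction F)
  case (insert g F)
  then obtain B where "0 < B" "\<forall>f\<in>F. \<forall>x. \<bar>f x\<bar> \<le> B" by auto
  moreover obtain C where "\<And>x. \<bar>g x\<bar> \<le> C" using bounded_continuousE[of g d] insert.prems by blast
  ultimately show ?case by (intro exI[of _ "max B C"]) (auto intro: le_max_iff_disj[THEN iffD2])
qed (auto intro: exI[of _ 1])

text \<open>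
  The point at time \<open>i\<close> of an orbit reads the original coordinates at \<open>n - i\<close>, hence the words to be
  concatenated are those at the coordinates \<open>0, -1, \<dots>, -(p-1)\<close>, and they are laid out leftwards.
\<close>

definition concat_blocks :: "nat \<Rightarrow> nat \<Rightarrow> (nat \<Rightarrow> int \<Rightarrow> 'a) \<Rightarrow> int \<Rightarrow> 'a" where
  "concat_blocks N p x n = x (nat ((- n) div int p mod int N)) (- ((- n) mod int p))"

lemma concat_blocks_periodic:
  assumes "0 < p"
  shows "(full_shift ^^ (N * p)) (concat_blocks N p x) = concat_blocks N p x"
proof
  fix n
  have eq: "- (n - int (N * p)) = - n + int N * int p" by simp
  have "(- n + int N * int p) div int p mod int N = - n div int p mod int N"
    "(- n + int N * int p) mod int p = - n mod int p"
    using assms by (simp_all del: add_uminus_conv_diff uminus_add_conv_diff)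
  then show "(full_shift ^^ (N * p)) (concat_blocks N p x) n = concat_blocks N p x n"
    unfolding shift_pow concat_blocks_def eq by (simp only:)
qed

text \<open>The conditions on \<open>i\<close> keep the window of radius \<open>m\<close> inside
  block \<open>j\<close>: since \<open>0 \<le> int i - n < int p\<close>, division by
  \<open>p\<close> returns exactly \<open>j\<close> and leaves the remainder
  \<open>int i - n\<close>.\<close>

lemma concat_blocks_agree:
  assumes "j < N" "m \<le> i" "i + m < p" "\<bar>n\<bar> \<le> int m"
  shows "(full_shift ^^ (j * p + i)) (concat_blocks N p x) n = (full_shift ^^ i) (x j) n"
proof -
  have eq: "- (n - int (j * p + i)) = (int i - n) + int j * int p" by simp
  have b: "0 \<le> int i - n" "int i - n < int p" using assms by auto
  have "((int i - n) + int j * int p) div int p = int j" using b by simp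
  moreover have "((int i - n) + int j * int p) mod int p = int i - n" using b by simp
  moreover have "nat (int j mod int N) = j" using assms(1) by simp
  ultimately show ?thesis unfolding shift_pow concat_blocks_def eq by simp
qed

text \<open>There are three errors of \<open>\<epsilon> / 3\<close>: sampling the integral at
  \<open>N\<close> points, copying the sampled words at positions away from block boundaries, and
  the positions near the boundaries. The block length \<open>p\<close> is fixed before
  \<open>N\<close>, because the sampled functions are the averages of length
  \<open>p\<close>.\<close>

lemma periodic_approximation:
  assumes \<mu>: "\<mu> \<in> invariant_measures d full_shift" and F: "finite F" "F \<subseteq> bounded_continuous d"
    and "0 < \<epsilon>"
  shows "\<exists>P>0. \<exists>z. (full_shift ^^ P) z = z \<and>
    (\<forall>f\<in>F. \<bar>birkhoff_avg full_shift P f z - (\<integral>x. f x \<partial>\<mu>)\<bar> < \<epsilon>)"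
proof -
  interpret prob_space \<mu> using \<mu> by (simp add: invariant_measures_def)
  have sets: "sets \<mu> = sets (borel_metric d)" using \<mu> by (simp add: invariant_measures_def)
  note T = measurable_shift[OF sets]
  obtain B where "0 < B" and B: "\<And>f x. f \<in> F \<Longrightarrow> \<bar>f x\<bar> \<le> B"
    using bounded_continuous_abs_bound_finite[OF F] by blast
  obtain m \<delta> where "0 < \<delta>" and m: "\<And>f x y. f \<in> F \<Longrightarrow>
      (\<forall>n. \<bar>n\<bar> \<le> int m \<longrightarrow> dist (x n) (y n) < \<delta>) \<Longrightarrow> \<bar>f x - f y\<bar> < \<epsilon> / 3"
    using bounded_continuous_uniform_finite[OF F, of "\<epsilon> / 3"] \<open>0 < \<epsilon>\<close> by (metis zero_less_divide_iff zero_less_numeral)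
  \<comment> \<open>At most \<open>2 * m\<close> positions per block have a window leaving the
    block, each costing at most \<open>2 * B\<close>; this \<open>p\<close> makes their share of the
    average less than \<open>\<epsilon> / 3\<close>.\<close>
  obtain p where p: "4 * real m * B / (\<epsilon> / 3) < real p" using reals_Archimedean2 by blast
  have "0 \<le> 4 * real m * B / (\<epsilon> / 3)" using \<open>0 < \<epsilon>\<close> \<open>0 < B\<close> by simp
  then have "0 < p" using p by (metis of_nat_0_less_iff order_le_less_trans)
  have p': "4 * real m * B \<le> real p * (\<epsilon> / 3)" using p \<open>0 < \<epsilon>\<close> by (simp add: field_simps)
  let ?G = "\<lambda>f. birkhoff_avg full_shift p f"
  have G_bound: "\<bar>?G f x\<bar> \<le> B" if "f \<in> F" for f x
  proof -
    have "\<bar>\<Sum>i<p. f ((full_shift ^^ i) x)\<bar> \<le> (\<Sum>i<p. B)"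
      by (intro order_trans[OF sum_abs] sum_mono B that)
    then show ?thesis using \<open>0 < p\<close> by (simp add: birkhoff_avg_def field_simps)
  qed
  have G_meas: "?G f \<in> borel_measurable \<mu>" if "f \<in> F" for f
    using that F by (intro bounded_continuous_measurable[OF Metric_space_d _ sets] bounded_continuous_birkhoff_avg) auto
  have G_int: "expectation (?G f) = expectation f" if "f \<in> F" for f
  proof -
    have "f \<in> bounded_continuous d" using that F by auto
    note f = bounded_continuous_measurable[OF Metric_space_d this sets]
    then show ?thesis
      using birkhoff_avg_invariant_set[OF \<mu> T f B[OF that] sets.top _ \<open>0 < p\<close>]
      by (simp add: space_invariant_measure[OF \<mu>])
  qed
  have "\<exists>N>0. \<exists>x. \<forall>f\<in>F. \<bar>(\<Sum>j<N. ?G f (x j)) / real N - expectation (?G f)\<bar> < \<epsilon> / 3"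
    by (rule empirical_approximation) (use F G_meas G_bound \<open>0 < \<epsilon>\<close> in auto)
  then obtain N x where "0 < N" and x: "\<And>f. f \<in> F \<Longrightarrow>
      \<bar>(\<Sum>j<N. ?G f (x j)) / real N - expectation (?G f)\<bar> < \<epsilon> / 3"
    by blast
  define z where "z = concat_blocks N p x"
  have "\<bar>birkhoff_avg full_shift (N * p) f z - (\<integral>x. f x \<partial>\<mu>)\<bar> < \<epsilon>" if f: "f \<in> F" for f
  proof -
    have block: "\<bar>(\<Sum>i<p. f ((full_shift ^^ (j * p + i)) z)) - (\<Sum>i<p. f ((full_shift ^^ i) (x j)))\<bar>
        \<le> real p * (2 * (\<epsilon> / 3))" if j: "j < N" for j
    proof -
      have "\<bar>f ((full_shift ^^ (j * p + i)) z) - f ((full_shift ^^ i) (x j))\<bar>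
          \<le> \<epsilon> / 3 + (if i \<in> {..<m} \<union> {p - m..<p} then 2 * B else 0)" if "i < p" for i
      proof (cases "m \<le> i \<and> i + m < p")
        case True
        then have "\<bar>f ((full_shift ^^ (j * p + i)) z) - f ((full_shift ^^ i) (x j))\<bar> < \<epsilon> / 3"
          using concat_blocks_agree[OF j, of m i p _ x] \<open>0 < \<delta>\<close> by (intro m[OF f]) (auto simp: z_def)
        then show ?thesis using \<open>0 < B\<close> by auto
      next
        case False
        then have "i \<in> {..<m} \<union> {p - m..<p}" using that by auto
        moreover have "\<bar>f ((full_shift ^^ (j * p + i)) z) - f ((full_shift ^^ i) (x j))\<bar> \<le> 2 * B"
          using B[OF f, of "(full_shift ^^ (j * p + i)) z"] B[OF f, of "(full_shift ^^ i) (x j)"] by linarith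
        ultimately show ?thesis using \<open>0 < \<epsilon>\<close> by simp
      qed
      then have "\<bar>\<Sum>i<p. f ((full_shift ^^ (j * p + i)) z) - f ((full_shift ^^ i) (x j))\<bar>
          \<le> (\<Sum>i<p. \<epsilon> / 3 + (if i \<in> {..<m} \<union> {p - m..<p} then 2 * B else 0))"
        by (intro order_trans[OF sum_abs] sum_mono) auto
      also have "\<dots> = real p * (\<epsilon> / 3) + 2 * B * real (card ({..<p} \<inter> ({..<m} \<union> {p - m..<p})))"
        by (simp add: sum.distrib sum.If_cases del: lessThan_iff Un_iff)
      also have "\<dots> \<le> real p * (\<epsilon> / 3) + 2 * B * real (2 * m)"
      proof -
        have "card ({..<p} \<inter> ({..<m} \<union> {p - m..<p})) \<le> card ({..<m} \<union> {p - m..<p})"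
          by (intro card_mono) auto
        also have "\<dots> \<le> card {..<m} + card {p - m..<p}" by (rule card_Un_le)
        also have "\<dots> \<le> 2 * m" by simp
        finally show ?thesis using \<open>0 < B\<close> by (intro add_left_mono mult_left_mono) auto
      qed
      also have "\<dots> \<le> real p * (2 * (\<epsilon> / 3))" using p' by (simp add: ac_simps)
      finally show ?thesis by (simp add: sum_subtractf)
    qed
    have eq1: "birkhoff_avg full_shift (N * p) f z
        = (\<Sum>j<N. \<Sum>i<p. f ((full_shift ^^ (j * p + i)) z)) / (real N * real p)"
      unfolding birkhoff_avg_def sum_blocks by simp
    have eq2: "(\<Sum>j<N. ?G f (x j)) / real N
        = (\<Sum>j<N. \<Sum>i<p. f ((full_shift ^^ i) (x j))) / (real N * real p)"
      unfolding birkhoff_avg_def by (simp add: mult.commute flip: sum_divide_distrib)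
    have "\<bar>(\<Sum>j<N. \<Sum>i<p. f ((full_shift ^^ (j * p + i)) z)) - (\<Sum>j<N. \<Sum>i<p. f ((full_shift ^^ i) (x j)))\<bar>
        \<le> (\<Sum>j<N. real p * (2 * (\<epsilon> / 3)))"
      by (subst sum_subtractf[symmetric], rule order_trans[OF sum_abs], rule sum_mono, rule block) simp
    also have "\<dots> = (real N * real p) * (2 * (\<epsilon> / 3))" by simp
    finally have "\<bar>birkhoff_avg full_shift (N * p) f z - (\<Sum>j<N. ?G f (x j)) / real N\<bar> \<le> 2 * (\<epsilon> / 3)"
      unfolding eq1 eq2 diff_divide_distrib[symmetric] abs_divide
      using \<open>0 < N\<close> \<open>0 < p\<close> by (simp add: divide_le_eq mult.commute)
    then show ?thesis using x[OF f] G_int[OF f] by linarith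
  qed
  moreover have "(full_shift ^^ (N * p)) z = z"
    unfolding z_def by (rule concat_blocks_periodic[OF \<open>0 < p\<close>])
  ultimately show ?thesis using \<open>0 < N\<close> \<open>0 < p\<close> by (intro exI[of _ "N * p"] conjI exI[of _ z]) auto
qed

end

section \<open>Spreading a periodic orbit\<close>

context compact_full_shift
begin

text \<open>For \<open>s < 2 ^ q\<close> the block of length \<open>q\<close> starting at coordinate
  \<open>- (s * q)\<close> carries the binary digits of \<open>s\<close>: digit 1 applies
  \<open>g\<close>, digit 0 keeps the letter. The minus sign numbers blocks in the order in which
  the orbit meets them; reduction modulo \<open>2 ^ q\<close> makes the pattern periodic.\<close>

definition binary_perturbation :: "('a \<Rightarrow> 'a) \<Rightarrow> nat \<Rightarrow> (int \<Rightarrow> 'a) \<Rightarrow> int \<Rightarrow> 'a" where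
  "binary_perturbation g q z j =
     (if bit ((- (j div int q)) mod 2 ^ q) (nat (j mod int q)) then g (z j) else z j)"

text \<open>The shift changes the block number by \<open>2 ^ q\<close>, which is invisible modulo
  \<open>2 ^ q\<close>, keeps positions inside blocks, and fixes \<open>z\<close> because
  \<open>P\<close> divides \<open>q\<close>.\<close>

lemma binary_perturbation_periodic:
  assumes z: "(full_shift ^^ P) z = z" and "P dvd q" and "0 < q"
  shows "(full_shift ^^ (q * 2 ^ q)) (binary_perturbation g q z) = binary_perturbation g q z"
proof
  fix n
  obtain l where l: "q * 2 ^ q = P * l" using \<open>P dvd q\<close> by (metis dvd_def mult.assoc)
  have zn: "z (n - int (q * 2 ^ q)) = z n"
    unfolding shift_pow[symmetric] l using funpow_mult_periodic[OF z] by simp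
  have eq: "n - int (q * 2 ^ q) = n + (- (2 ^ q)) * int q" by simp
  have 1: "(n + (- (2 ^ q)) * int q) div int q = n div int q + - (2 ^ q)"
    using \<open>0 < q\<close> by (subst div_mult_self1) auto
  have 2: "(n + (- (2 ^ q)) * int q) mod int q = n mod int q"
    by (rule mod_mult_self1)
  have 3: "(- (n div int q + - (2 ^ q))) mod 2 ^ q = (- (n div int q)) mod 2 ^ q"
    by simp
  have "(full_shift ^^ (q * 2 ^ q)) (binary_perturbation g q z) n
    = (if bit ((- ((n + (- (2 ^ q)) * int q) div int q)) mod 2 ^ q) (nat ((n + (- (2 ^ q)) * int q) mod int q))
       then g (z n) else z n)"
    unfolding shift_pow binary_perturbation_def zn unfolding eq ..
  then show "(full_shift ^^ (q * 2 ^ q)) (binary_perturbation g q z) n = binary_perturbation g q z n"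
    unfolding 1 2 3 binary_perturbation_def .
qed

text \<open>
  The blocks of length \<open>q\<close> of the perturbed point run through all binary words of length \<open>q\<close>, and a
  window of length \<open>2q\<close> contains a whole block; hence each residue class modulo \<open>q\<close> contains at
  most one time at which the orbit visits a given small ball.
\<close>

lemma card_visits_le:
  assumes z: "(full_shift ^^ P) z = z" and "P dvd q" and "0 < q"
    and sep: "\<And>n. 8 * \<eta> < dist (g (z n)) (z n)" and wt: "8 * \<eta> < 1 / (a (2 * q) + 1)"
  shows "card {i. i < q * 2 ^ q \<and> (full_shift ^^ i) (binary_perturbation g q z) \<in> mcball y (4 * \<eta>)} \<le> q"
    (is "card ?S \<le> q")
proof -
  let ?w = "binary_perturbation g q z"
  have "inj_on (\<lambda>i. i mod q) ?S"
  proof (rule inj_onI)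
    fix i i' assume i: "i \<in> ?S" and i': "i' \<in> ?S" and cong: "i mod q = i' mod q"
    define t t' where "t = i div q" and "t' = i' div q"
    have lt: "t < 2 ^ q" "t' < 2 ^ q"
      using i i' by (auto simp: t_def t'_def less_mult_imp_div_less mult.commute)
    have dec: "i = t * q + i mod q" by (simp add: t_def)
    have dec': "i' = t' * q + i mod q" unfolding cong by (simp add: t'_def)
    note dec = dec dec'
    have close: "d ((full_shift ^^ i) ?w) ((full_shift ^^ i') ?w) \<le> 8 * \<eta>"
      using i i' triangle[of "(full_shift ^^ i) ?w" y "(full_shift ^^ i') ?w"]
        commute[of y "(full_shift ^^ i) ?w"] by auto
    have val: "?w (int b - int (s * q)) = (if bit (int s) b then g (z (int b)) else z (int b))"
      if "b < q" "s < 2 ^ q" for b s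
    proof -
      obtain l where l: "s * q = P * l" using \<open>P dvd q\<close> by (metis dvd_def dvd_mult)
      have "z (int b - int (s * q)) = z (int b)"
        unfolding shift_pow[symmetric] l using funpow_mult_periodic[OF z] by simp
      moreover have eq: "int b - int (s * q) = int b + (- int s) * int q" by simp
      have "(int b + (- int s) * int q) div int q = - int s"
        using that by (subst div_mult_self1) auto
      moreover have "(int b + (- int s) * int q) mod int q = int b"
        using that by (subst mod_mult_self1) auto
      moreover have "int s mod 2 ^ q = int s"
        using that by (metis mod_less of_nat_mod of_nat_numeral of_nat_power)
      ultimately show ?thesis
        unfolding binary_perturbation_def unfolding eq by simp
    qed
    have "bit (int t) b = bit (int t') b" if "b < q" for b
    proof (rule ccontr)
      assume neq: "bit (int t) b \<noteq> bit (int t') b"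
      \<comment> \<open>Both times are \<open>i mod q\<close> past a multiple of \<open>q\<close>,
        so at this coordinate each shifted point shows digit \<open>b\<close> of its own block. The
        coordinate is at most \<open>2 * q\<close>, which bounds its weight from below.\<close>
      define n where "n = int b + int (i mod q)"
      have n: "0 \<le> n" "n \<le> int (2 * q)"
        using that \<open>0 < q\<close> mod_less_divisor[OF \<open>0 < q\<close>, of i] unfolding n_def by linarith+
      have "n - int i = int b - int (t * q)" "n - int i' = int b - int (t' * q)"
        using dec unfolding n_def by linarith+
      then have w: "(full_shift ^^ i) ?w n = (if bit (int t) b then g (z (int b)) else z (int b))"
        "(full_shift ^^ i') ?w n = (if bit (int t') b then g (z (int b)) else z (int b))"
        unfolding shift_pow using val[OF that] lt by simp_all
      have "dist ((full_shift ^^ i) ?w n) ((full_shift ^^ i') ?w n) > 8 * \<eta>"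
        unfolding w using neq sep[of "int b"] by (auto simp: dist_commute)
      moreover have "8 * \<eta> < weight n"
      proof -
        have "a (nat \<bar>n\<bar>) \<le> a (2 * q)" using n by (intro monoD[OF mono_a]) auto
        then have "1 / (a (2 * q) + 1) \<le> weight n"
          unfolding weight_def using a_nonneg[of "nat \<bar>n\<bar>"] by (intro divide_left_mono) auto
        then show ?thesis using wt by linarith
      qed
      ultimately show False
        using close coordinate_le_d[of n "(full_shift ^^ i) ?w" "(full_shift ^^ i') ?w"] by linarith
    qed
    moreover have "\<not> bit (int s) b" if "s < 2 ^ q" "q \<le> b" for s b
    proof -
      have "s div 2 ^ b = 0" using that by (meson div_less less_le_trans one_le_numeral power_increasing)
      then have "int s div 2 ^ b = 0"
        by (metis of_nat_0 of_nat_numeral of_nat_power zdiv_int)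
      then show ?thesis by (simp add: bit_iff_odd)
    qed
    ultimately have "bit (int t) b = bit (int t') b" for b
      using lt by (cases "b < q") auto
    then have "int t = int t'" by (intro bit_eqI) blast
    then show "i = i'" using dec by simp
  qed
  then have "card ?S = card ((\<lambda>i. i mod q) ` ?S)" by (simp add: card_image)
  also have "\<dots> \<le> card {..<q}" using \<open>0 < q\<close> by (intro card_mono) auto
  finally show ?thesis by simp
qed

section \<open>Scales dictated by the growth of \<open>a\<close>\<close>

lemma tendsto_inverse_a: "(\<lambda>k. 1 / (a k + 1)) \<longlonglongrightarrow> 0"
  using summable_a by (rule summable_LIMSEQ_zero)

text \<open>Eight times the radius \<open>1 / (16 * (a (2 * q) + 1))\<close> is half the least
  weight within distance \<open>2 * q\<close> of the origin, and has to stay below the letter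
  separation \<open>s\<close> too. The last conjunct says that the mass \<open>(1 / 2) ^ q\<close>
  is smaller than the n-th power of the radius.\<close>

lemma scale_eventually:
  assumes "0 < s"
  shows "\<forall>\<^sub>F q in sequentially. 1 / (16 * (a (2 * q) + 1)) \<le> 1 / real (Suc n) \<and>
    8 * (1 / (16 * (a (2 * q) + 1))) < s \<and>
    (1 / 2) ^ q < (1 / (16 * (a (2 * q) + 1))) ^ n"
proof -
  have "(\<lambda>q. 1 / (a (2 * q) + 1)) \<longlonglongrightarrow> 0"
    using LIMSEQ_subseq_LIMSEQ[OF tendsto_inverse_a, of "\<lambda>q. 2 * q"] by (simp add: o_def strict_mono_def)
  then have lim: "\<forall>\<^sub>F q in sequentially. 1 / (a (2 * q) + 1) < c" if "0 < c" for c
    using that by (rule order_tendstoD)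
  have ev1: "\<forall>\<^sub>F q in sequentially. 1 / (a (2 * q) + 1) < 1 / real (Suc n)"
    and ev2: "\<forall>\<^sub>F q in sequentially. 1 / (a (2 * q) + 1) < s"
    using assms by (auto intro!: lim simp del: of_nat_Suc)
  \<comment> \<open>The exponent \<open>q * ln 2\<close> is split in halves: this \<alpha> keeps
    \<open>n * \<alpha> * 2 * q\<close> within one, and \<open>ev4\<close> keeps
    \<open>n * ln 32\<close> strictly within the other. The 32 arises from
    \<open>a + 1 \<le> 2 * e\<close> times 16.\<close>
  define \<alpha> where "\<alpha> = ln 2 / (4 * real (Suc n))"
  have "0 < \<alpha>" by (simp add: \<alpha>_def)
  have "(\<lambda>q. a (2 * q) / exp (\<alpha> * real (2 * q))) \<longlonglongrightarrow> 0"
    using LIMSEQ_subseq_LIMSEQ[OF growth[OF \<open>0 < \<alpha>\<close>], of "\<lambda>q. 2 * q"] by (simp add: o_def strict_mono_def)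
  then have ev3: "\<forall>\<^sub>F q in sequentially. a (2 * q) / exp (\<alpha> * real (2 * q)) < 1"
    by (rule order_tendstoD) simp
  have ev4: "\<forall>\<^sub>F q in sequentially. 2 * ln (32 :: real) * real n / ln 2 < real q"
    by (rule eventually_gt_at_top[THEN filterlim_real_sequentially[THEN filterlim_iff[THEN iffD1], rule_format]])
  show ?thesis
    using ev1 ev2 ev3 ev4
  proof eventually_elim
    case (elim q)
    let ?A = "a (2 * q) + 1"
    have A: "1 \<le> ?A" using a_nonneg[of "2 * q"] by simp
    have small: "1 / (16 * ?A) \<le> 1 / ?A" "8 * (1 / (16 * ?A)) \<le> 1 / ?A"
      using A by (auto simp: field_simps)
    define e where "e = exp (\<alpha> * real (2 * q))"
    have "a (2 * q) < e" using elim(3) by (simp add: e_def field_simps)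
    moreover have "1 \<le> e" using \<open>0 < \<alpha>\<close> by (simp add: e_def)
    ultimately have "16 * ?A \<le> 32 * e" by simp
    then have "16 * ?A \<le> exp (ln 32) * exp (\<alpha> * real (2 * q))" by (simp only: e_def exp_ln zero_less_numeral)
    also have "\<dots> = exp (ln 32 + \<alpha> * real (2 * q))" by (simp add: exp_add)
    finally have "(16 * ?A) ^ n \<le> exp (ln 32 + \<alpha> * real (2 * q)) ^ n"
      using A by (intro power_mono) auto
    also have "\<dots> = exp (real n * (ln 32 + \<alpha> * real (2 * q)))" by (rule exp_of_nat_mult[symmetric])
    also have "\<dots> < exp (real q * ln 2)"
    proof -
      have "real n * ln 32 < real q * ln 2 / 2"
        using elim(4) by (simp add: field_simps)
      moreover have "real n * (\<alpha> * real (2 * q)) \<le> real q * ln 2 / 2"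
      proof -
        have "real n * (\<alpha> * real (2 * q)) = (real n / real (Suc n)) * (real q * ln 2 / 2)"
          by (simp add: \<alpha>_def field_simps del: of_nat_Suc)
        also have "\<dots> \<le> 1 * (real q * ln 2 / 2)" by (intro mult_right_mono) auto
        finally show ?thesis by simp
      qed
      ultimately show ?thesis by (simp add: distrib_left)
    qed
    also have "\<dots> = 2 ^ q" by (simp add: exp_of_nat_mult)
    finally have "(16 * ?A) ^ n < 2 ^ q" .
    then have "(1 / 2) ^ q < (1 / (16 * ?A)) ^ n"
      using A by (simp add: power_one_over field_simps)
    with order_trans[OF small(1) less_imp_le[OF elim(1)]] le_less_trans[OF small(2) elim(2)]
    show ?case by blast
  qed
qed

text \<open>The order of choices matters: \<open>F\<close> fixes how far letters may move, this
  fixes \<open>g\<close>, the finitely many letters of the orbit then have a positive least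
  displacement \<open>s\<close>, and only then is \<open>q\<close> taken so large that
  \<open>8 * \<eta>\<close> drops below \<open>s\<close>.\<close>

lemma spread_periodic_point:
  assumes z: "(full_shift ^^ P) z = z" and "0 < P"
    and F: "finite F" "F \<subseteq> bounded_continuous d" and "0 < \<epsilon>"
  shows "\<exists>Q>0. \<exists>w \<eta>. (full_shift ^^ Q) w = w \<and>
    (\<forall>f\<in>F. \<bar>birkhoff_avg full_shift Q f w - birkhoff_avg full_shift P f z\<bar> < \<epsilon>) \<and>
    0 < \<eta> \<and> \<eta> \<le> 1 / real (Suc n) \<and>
    (\<forall>y. real (card {i. i < Q \<and> (full_shift ^^ i) w \<in> mcball y (4 * \<eta>)}) / real Q < \<eta> ^ n)"
proof -
  obtain m \<delta> where "0 < \<delta>" and m: "\<And>f x y. f \<in> F \<Longrightarrow>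
      (\<forall>n. \<bar>n\<bar> \<le> int m \<longrightarrow> dist (x n) (y n) < \<delta>) \<Longrightarrow> \<bar>f x - f y\<bar> < \<epsilon> / 2"
    using bounded_continuous_uniform_finite[OF F, of "\<epsilon> / 2"] \<open>0 < \<epsilon>\<close> by (metis half_gt_zero)
  have "\<exists>v. v \<noteq> u \<and> dist v u < \<delta>" for u :: 'a
  proof -
    have "u islimpt UNIV" by (rule islimpt_UNIV)
    then show ?thesis using \<open>0 < \<delta>\<close> unfolding islimpt_approachable by blast
  qed
  then obtain g where g: "\<And>u::'a. g u \<noteq> u" "\<And>u. dist (g u) u < \<delta>" by metis
  define s where "s = Min ((\<lambda>k. dist (g (z k)) (z k)) ` {0..<int P})"
  have s_le: "s \<le> dist (g (z k)) (z k)" for k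
  proof -
    have "z k = z (k mod int P)"
    \<comment> \<open>Iterates of the shift only lower coordinates: a nonnegative \<open>k\<close>
      is moved down into the period, while a negative one is reached from its residue.\<close>
    proof (cases "0 \<le> k")
      case True
      have "(full_shift ^^ (P * nat (k div int P))) z k = z (k mod int P)"
        unfolding shift_pow using True \<open>0 < P\<close>
        by (simp add: minus_mult_div_eq_mod pos_imp_zdiv_nonneg_iff)
      then show ?thesis using funpow_mult_periodic[OF z] by simp
    next
      case False
      have "(full_shift ^^ (P * nat (- (k div int P)))) z (k mod int P) = z k"
        unfolding shift_pow using False \<open>0 < P\<close>
        by (simp add: div_neg_pos_less0 less_imp_le)
      then show ?thesis using funpow_mult_periodic[OF z] by simp
    qed
    moreover have "s \<le> dist (g (z (k mod int P))) (z (k mod int P))"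
      unfolding s_def using \<open>0 < P\<close> by (intro Min_le) auto
    ultimately show ?thesis by simp
  qed
  have "0 < s" unfolding s_def using \<open>0 < P\<close> g(1) by (subst Min_gr_iff) auto
  obtain q0 where q0: "\<And>q. q \<ge> q0 \<Longrightarrow> 1 / (16 * (a (2 * q) + 1)) \<le> 1 / real (Suc n) \<and>
    8 * (1 / (16 * (a (2 * q) + 1))) < s \<and> (1 / 2) ^ q < (1 / (16 * (a (2 * q) + 1))) ^ n"
    using scale_eventually[OF \<open>0 < s\<close>, of n] unfolding eventually_sequentially by blast
  \<comment> \<open>At least \<open>q0\<close>, and a multiple of \<open>P\<close>, so that moving
    by whole blocks leaves \<open>z\<close> unchanged.\<close>
  define q where "q = P * Suc q0"
  have "q0 \<le> q" "0 < q" "P dvd q" using \<open>0 < P\<close> by (auto simp: q_def intro: trans_le_add2)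
  define \<eta> where "\<eta> = 1 / (16 * (a (2 * q) + 1))"
  have A: "0 < a (2 * q) + 1" using a_nonneg[of "2 * q"] by simp
  have \<eta>: "0 < \<eta>" "\<eta> \<le> 1 / real (Suc n)" "8 * \<eta> < s" "(1 / 2) ^ q < \<eta> ^ n"
    using q0[OF \<open>q0 \<le> q\<close>] A unfolding \<eta>_def by auto
  have wt: "8 * \<eta> < 1 / (a (2 * q) + 1)" using A by (simp add: \<eta>_def field_simps)
  define w where "w = binary_perturbation g q z"
  let ?Q = "q * 2 ^ q"
  have w: "(full_shift ^^ ?Q) w = w"
    unfolding w_def by (rule binary_perturbation_periodic[OF z \<open>P dvd q\<close> \<open>0 < q\<close>])
  have "\<bar>birkhoff_avg full_shift ?Q f w - birkhoff_avg full_shift P f z\<bar> < \<epsilon>" if f: "f \<in> F" for f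
  proof -
    have eq: "birkhoff_avg full_shift P f z = birkhoff_avg full_shift ?Q f z"
    proof -
      have "?Q = P * (Suc q0 * 2 ^ q)" by (simp only: q_def mult.assoc)
      then show ?thesis using birkhoff_avg_mult[OF z \<open>0 < P\<close>, of "Suc q0 * 2 ^ q"] by simp
    qed
    have tm: "\<bar>f ((full_shift ^^ i) w) - f ((full_shift ^^ i) z)\<bar> < \<epsilon> / 2" for i
    proof (rule m[OF f], intro allI impI)
      fix k show "dist ((full_shift ^^ i) w k) ((full_shift ^^ i) z k) < \<delta>"
        unfolding shift_pow w_def binary_perturbation_def using g(2) \<open>0 < \<delta>\<close> by auto
    qed
    have "\<bar>(\<Sum>i<?Q. f ((full_shift ^^ i) w)) - (\<Sum>i<?Q. f ((full_shift ^^ i) z))\<bar> \<le> (\<Sum>i<?Q. \<epsilon> / 2)"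
      unfolding sum_subtractf[symmetric]
      by (intro order_trans[OF sum_abs] sum_mono less_imp_le tm)
    then have "\<bar>birkhoff_avg full_shift ?Q f w - birkhoff_avg full_shift ?Q f z\<bar> \<le> \<epsilon> / 2"
      unfolding birkhoff_avg_def diff_divide_distrib[symmetric] abs_divide
      using \<open>0 < q\<close> by (simp add: divide_le_eq mult.commute)
    then show ?thesis using eq \<open>0 < \<epsilon>\<close> by simp
  qed
  moreover have "real (card {i. i < ?Q \<and> (full_shift ^^ i) w \<in> mcball y (4 * \<eta>)}) / real ?Q < \<eta> ^ n" for y
  proof -
    have "8 * \<eta> < dist (g (z k)) (z k)" for k using s_le[of k] \<eta>(3) by linarith
    then have "card {i. i < ?Q \<and> (full_shift ^^ i) w \<in> mcball y (4 * \<eta>)} \<le> q"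
      unfolding w_def by (rule card_visits_le[OF z \<open>P dvd q\<close> \<open>0 < q\<close> _ wt])
    then have "real (card {i. i < ?Q \<and> (full_shift ^^ i) w \<in> mcball y (4 * \<eta>)}) / real ?Q \<le> real q / real ?Q"
      by (intro divide_right_mono) auto
    also have "\<dots> = (1 / 2) ^ q" using \<open>0 < q\<close> by (simp add: power_one_over)
    finally show ?thesis using \<eta>(4) by linarith
  qed
  ultimately show ?thesis
    using w \<eta>(1,2) \<open>0 < q\<close> by (intro exI[of _ ?Q] conjI exI[of _ w] exI[of _ \<eta>]) auto
qed

end

section \<open>Generic measures\<close>

context compact_full_shift
begin

text \<open>A continuous substitute for ball masses: it lies between the indicators of the closed
  balls of radii \<open>3 * \<rho>\<close> and \<open>4 * \<rho>\<close>.\<close>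

definition bump :: "(int \<Rightarrow> 'a) \<Rightarrow> real \<Rightarrow> (int \<Rightarrow> 'a) \<Rightarrow> real" where
  "bump y \<rho> x = max 0 (min 1 (4 - d y x / \<rho>))"

lemma bump_bounded_continuous: "bump y \<rho> \<in> bounded_continuous d"
proof (rule bounded_continuousI)
  show "continuous_map mtopology euclideanreal (bump y \<rho>)"
    unfolding bump_def[abs_def] divide_inverse
    by (intro continuous_intros continuous_map_dist_from Metric_space_d)
  show "\<bar>bump y \<rho> x\<bar> \<le> 1" for x by (simp add: bump_def)
qed

lemma indicator_le_bump: "0 < \<rho> \<Longrightarrow> indicator (mcball y (3 * \<rho>)) x \<le> bump y \<rho> x"
  by (auto simp: bump_def indicator_def field_simps)

lemma bump_le_indicator: "0 < \<rho> \<Longrightarrow> bump y \<rho> x \<le> indicator (mcball y (4 * \<rho>)) x"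
  by (auto simp: bump_def indicator_def field_simps)

text \<open>
  The three conditions below are open in the weak topology because they only involve integrals of
  continuous functions, and each of them holds for suitable measures on periodic orbits.
\<close>

definition concentrated :: "nat \<Rightarrow> (int \<Rightarrow> 'a) measure set" where
  "concentrated n = {\<mu> \<in> invariant_measures d full_shift. \<exists>Y \<rho>. finite Y \<and> 0 < \<rho> \<and> 2 * \<rho> \<le> (1 / 2) ^ n \<and>
     real (card Y) * (2 * \<rho>) powr (1 / real (Suc n)) \<le> (1 / 2) ^ n \<and>
     1 - 1 / real (Suc n) < (\<integral>x. min 1 (\<Sum>y\<in>Y. bump y (\<rho> / 8) x) \<partial>\<mu>)}"

text \<open>The finite net stands for all centres: a ball of radius \<open>2 * \<epsilon>\<close>
  lies in the ball of radius \<open>3 * \<epsilon>\<close> around a net point, where the bump is 1.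
  Only finitely many strict inequalities remain, hence openness.\<close>

definition spread :: "nat \<Rightarrow> (int \<Rightarrow> 'a) measure set" where
  "spread n = {\<mu> \<in> invariant_measures d full_shift. \<exists>Y \<epsilon>. finite Y \<and> (\<forall>x. \<exists>y\<in>Y. d y x < \<epsilon>) \<and>
     0 < \<epsilon> \<and> \<epsilon> \<le> 1 / real (Suc n) \<and> (\<forall>y\<in>Y. (\<integral>x. bump y \<epsilon> x \<partial>\<mu>) < \<epsilon> ^ n)}"

text \<open>By invariance the Birkhoff average has the mean of \<open>f\<close>, so the difference
  is its variance.\<close>

definition averaging :: "((int \<Rightarrow> 'a) \<Rightarrow> real) \<Rightarrow> nat \<Rightarrow> (int \<Rightarrow> 'a) measure set" where
  "averaging f n = {\<mu> \<in> invariant_measures d full_shift. \<exists>N>0.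
     (\<integral>x. (birkhoff_avg full_shift N f x)\<^sup>2 \<partial>\<mu>) - (\<integral>x. f x \<partial>\<mu>)\<^sup>2 < 1 / real (Suc n)}"

abbreviation weak :: "(int \<Rightarrow> 'a) measure topology" where
  "weak \<equiv> weak_topology d full_shift"

section \<open>Openness of the three conditions\<close>

lemma openin_weak_less:
  assumes "continuous_map weak euclideanreal h"
  shows "openin weak {\<mu> \<in> invariant_measures d full_shift. h \<mu> < c}"
    and "openin weak {\<mu> \<in> invariant_measures d full_shift. c < h \<mu>}"
  using openin_continuous_map_preimage[OF assms, of "{..<c}"]
    openin_continuous_map_preimage[OF assms, of "{c<..}"] by auto

lemma openin_concentrated: "openin weak (concentrated n)"
proof -
  have "(\<lambda>x. min 1 (\<Sum>y\<in>Y. bump y (\<rho> / 8) x)) \<in> bounded_continuous d" if "finite Y" for Y \<rho>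
  proof (rule bounded_continuousI)
    show "continuous_map mtopology euclideanreal (\<lambda>x. min 1 (\<Sum>y\<in>Y. bump y (\<rho> / 8) x))"
      using that bump_bounded_continuous
      by (intro continuous_intros) (auto simp: bounded_continuous_def)
    fix x
    have "0 \<le> (\<Sum>y\<in>Y. bump y (\<rho> / 8) x)" by (intro sum_nonneg) (simp add: bump_def)
    then show "\<bar>min 1 (\<Sum>y\<in>Y. bump y (\<rho> / 8) x)\<bar> \<le> 1" by linarith
  qed
  then have op: "openin weak {\<mu> \<in> invariant_measures d full_shift. c < (\<integral>x. min 1 (\<Sum>y\<in>Y. bump y (\<rho> / 8) x) \<partial>\<mu>)}"
    if "finite Y" for Y \<rho> c
    using that by (intro openin_weak_less continuous_map_weak_integral) auto
  let ?I = "{(Y, \<rho>). finite Y \<and> 0 < \<rho> \<and> 2 * \<rho> \<le> (1 / 2) ^ n \<and>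
     real (card Y) * (2 * \<rho>) powr (1 / real (Suc n)) \<le> (1 / 2) ^ n}"
  have "concentrated n = \<Union>((\<lambda>(Y, \<rho>). {\<mu> \<in> invariant_measures d full_shift.
     1 - 1 / real (Suc n) < (\<integral>x. min 1 (\<Sum>y\<in>Y. bump y (\<rho> / 8) x) \<partial>\<mu>)}) ` ?I)"
    unfolding concentrated_def by blast
  also have "openin weak \<dots>"
    using op by (intro openin_Union) auto
  finally show ?thesis .
qed

lemma openin_spread: "openin weak (spread n)"
proof -
  let ?I = "{(Y, \<epsilon>). finite Y \<and> (\<forall>x. \<exists>y\<in>Y. d y x < \<epsilon>) \<and> 0 < \<epsilon> \<and> \<epsilon> \<le> 1 / real (Suc n)}"
  let ?U = "\<lambda>(Y, \<epsilon>). {\<mu> \<in> invariant_measures d full_shift. \<forall>y\<in>Y. (\<integral>x. bump y \<epsilon> x \<partial>\<mu>) < \<epsilon> ^ n}"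
  have "openin weak (?U (Y, \<epsilon>))" if "finite Y" for Y \<epsilon>
    using that
  proof (induction Y)
    case empty
    then show ?case using openin_topspace[of weak] by simp
  next
    case (insert y Y)
    have "?U (insert y Y, \<epsilon>) = {\<mu> \<in> invariant_measures d full_shift. (\<integral>x. bump y \<epsilon> x \<partial>\<mu>) < \<epsilon> ^ n} \<inter> ?U (Y, \<epsilon>)"
      by auto
    then show ?case
      using openin_Int[OF openin_weak_less(1)[OF continuous_map_weak_integral[OF bump_bounded_continuous]] insert.IH]
      by simp
  qed
  then have "openin weak (\<Union>(?U ` ?I))" by (intro openin_Union) auto
  also have "\<Union>(?U ` ?I) = spread n" unfolding spread_def by blast
  finally show ?thesis .
qed

lemma birkhoff_avg_square_bounded_continuous:
  assumes "f \<in> bounded_continuous d"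
  shows "(\<lambda>x. (birkhoff_avg full_shift N f x)\<^sup>2) \<in> bounded_continuous d"
proof -
  note b = bounded_continuous_birkhoff_avg[OF assms, of N]
  obtain B where B: "\<And>x. \<bar>birkhoff_avg full_shift N f x\<bar> \<le> B" using bounded_continuousE[OF b] by blast
  show ?thesis
  proof (rule bounded_continuousI)
    show "continuous_map mtopology euclideanreal (\<lambda>x. (birkhoff_avg full_shift N f x)\<^sup>2)"
      using b by (intro continuous_intros) (auto simp: bounded_continuous_def)
    show "\<bar>(birkhoff_avg full_shift N f x)\<^sup>2\<bar> \<le> B\<^sup>2" for x
      using B[of x] by (metis abs_ge_zero abs_le_square_iff abs_of_nonneg abs_power2 order_trans)
  qed
qed

lemma openin_averaging:
  assumes "f \<in> bounded_continuous d"
  shows "openin weak (averaging f n)"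
proof -
  let ?U = "\<lambda>N. {\<mu> \<in> invariant_measures d full_shift.
     (\<integral>x. (birkhoff_avg full_shift N f x)\<^sup>2 \<partial>\<mu>) - (\<integral>x. f x \<partial>\<mu>)\<^sup>2 < 1 / real (Suc n)}"
  have "openin weak (?U N)" for N
    by (intro openin_weak_less continuous_intros continuous_map_weak_integral assms
        birkhoff_avg_square_bounded_continuous)
  then have "openin weak (\<Union>(?U ` {0<..}))" by (intro openin_Union) auto
  also have "\<Union>(?U ` {0<..}) = averaging f n" unfolding averaging_def by blast
  finally show ?thesis .
qed

section \<open>Periodic measures satisfying the conditions\<close>

lemma borel_shift: "full_shift \<in> measurable (borel_metric d) (borel_metric d)"
  by (rule measurable_shift) simp

lemma space_borel_d: "space (borel_metric d) = UNIV"
  by (simp add: borel_metric_def)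

abbreviation orbit :: "nat \<Rightarrow> (int \<Rightarrow> 'a) \<Rightarrow> (int \<Rightarrow> 'a) measure" where
  "orbit P z \<equiv> orbit_measure (borel_metric d) full_shift P z"

lemma integral_orbit:
  assumes "0 < P" "f \<in> bounded_continuous d"
  shows "(\<integral>x. f x \<partial>orbit P z) = birkhoff_avg full_shift P f z"
  by (rule integral_orbit_measure[OF assms(1) space_borel_d
        bounded_continuous_measurable[OF Metric_space_d assms(2) refl]])

text \<open>With \<open>N = P\<close> the average is constant on the orbit, so its variance
  vanishes.\<close>

lemma orbit_averaging:
  assumes z: "(full_shift ^^ P) z = z" and "0 < P" and f: "f \<in> bounded_continuous d"
  shows "orbit P z \<in> averaging f n"
proof -
  have "(\<integral>x. (birkhoff_avg full_shift P f x)\<^sup>2 \<partial>orbit P z)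
      = birkhoff_avg full_shift P (\<lambda>x. (birkhoff_avg full_shift P f x)\<^sup>2) z"
    by (rule integral_orbit[OF \<open>0 < P\<close> birkhoff_avg_square_bounded_continuous[OF f]])
  also have "\<dots> = (birkhoff_avg full_shift P f z)\<^sup>2"
    unfolding birkhoff_avg_def[of _ _ "\<lambda>x. (birkhoff_avg full_shift P f x)\<^sup>2"]
    using \<open>0 < P\<close> by (simp add: birkhoff_avg_periodic[OF z])
  finally show ?thesis
    using orbit_measure_invariant[OF \<open>0 < P\<close> z borel_shift] \<open>0 < P\<close> integral_orbit[OF \<open>0 < P\<close> f, of z]
    unfolding averaging_def by (auto intro!: exI[of _ P])
qed

lemma orbit_concentrated:
  assumes z: "(full_shift ^^ P) z = z" and "0 < P"
  shows "orbit P z \<in> concentrated n"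
proof -
  define Y where "Y = (\<lambda>i. (full_shift ^^ i) z) ` {..<P}"
  have "finite Y" by (simp add: Y_def)
  \<comment> \<open>Chosen with \<open>card Y * c < (1 / 2) ^ n\<close>; the second term in \<rho>
    then makes \<open>(2 * \<rho>) powr (1 / real (Suc n))\<close> at most \<open>c\<close>.\<close>
  define c where "c = (1 / 2) ^ n / (real (card Y) + 1)"
  have "0 < c" by (simp add: c_def)
  define \<rho> where "\<rho> = min ((1 / 2) ^ n) (c powr real (Suc n)) / 2"
  have "0 < \<rho>" using \<open>0 < c\<close> by (simp add: \<rho>_def)
  have "2 * \<rho> \<le> (1 / 2) ^ n" by (simp add: \<rho>_def)
  have "(2 * \<rho>) powr (1 / real (Suc n)) \<le> (c powr real (Suc n)) powr (1 / real (Suc n))"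
    using \<open>0 < \<rho>\<close> by (intro powr_mono2) (auto simp: \<rho>_def)
  also have "\<dots> = c" using \<open>0 < c\<close> by (simp add: powr_powr del: of_nat_Suc)
  finally have "real (card Y) * (2 * \<rho>) powr (1 / real (Suc n)) \<le> real (card Y) * c"
    by (intro mult_left_mono) auto
  also have "\<dots> = (1 / 2) ^ n * (real (card Y) / (real (card Y) + 1))" by (simp add: c_def)
  also have "\<dots> \<le> (1 / 2) ^ n" by (intro mult_left_le) (auto simp: field_simps)
  finally have card: "real (card Y) * (2 * \<rho>) powr (1 / real (Suc n)) \<le> (1 / 2) ^ n" .
  let ?f = "\<lambda>x. min 1 (\<Sum>y\<in>Y. bump y (\<rho> / 8) x)"
  have "?f \<in> borel_measurable (borel_metric d)"
    using bounded_continuous_measurable[OF Metric_space_d bump_bounded_continuous refl] by measurable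
  then have "(\<integral>x. ?f x \<partial>orbit P z) = birkhoff_avg full_shift P ?f z"
    by (rule integral_orbit_measure[OF \<open>0 < P\<close> space_borel_d])
  also have "\<dots> = 1"
  proof -
    have "?f ((full_shift ^^ i) z) = 1" if "i < P" for i
    proof -
      let ?y = "(full_shift ^^ i) z"
      have "1 = bump ?y (\<rho> / 8) ?y" by (simp add: bump_def)
      also have "\<dots> \<le> (\<Sum>y\<in>Y. bump y (\<rho> / 8) ?y)"
        using that \<open>finite Y\<close> by (intro member_le_sum) (auto simp: Y_def bump_def)
      finally show ?thesis by simp
    qed
    then show ?thesis using \<open>0 < P\<close> by (simp add: birkhoff_avg_def)
  qed
  finally have "1 - 1 / real (Suc n) < (\<integral>x. ?f x \<partial>orbit P z)" by simp
  then show ?thesis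
    using \<open>finite Y\<close> \<open>0 < \<rho>\<close> \<open>2 * \<rho> \<le> (1 / 2) ^ n\<close> card orbit_measure_invariant[OF \<open>0 < P\<close> z borel_shift]
    unfolding concentrated_def by blast
qed

lemma orbit_spread:
  assumes z: "(full_shift ^^ P) z = z" and "0 < P" and "0 < \<eta>" "\<eta> \<le> 1 / real (Suc n)"
    and card: "\<And>y. real (card {i. i < P \<and> (full_shift ^^ i) z \<in> mcball y (4 * \<eta>)}) / real P < \<eta> ^ n"
  shows "orbit P z \<in> spread n"
proof -
  have inv: "orbit P z \<in> invariant_measures d full_shift"
    by (rule orbit_measure_invariant[OF \<open>0 < P\<close> z borel_shift])
  interpret orb: prob_space "orbit P z" by (rule prob_space_orbit_measure[OF \<open>0 < P\<close> space_borel_d])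
  obtain Y where Y: "finite Y" "\<And>x. \<exists>y\<in>Y. d y x < \<eta>" using finite_net[OF \<open>0 < \<eta>\<close>] by blast
  have "(\<integral>x. bump y \<eta> x \<partial>orbit P z) < \<eta> ^ n" for y
  proof -
    have "(\<integral>x. bump y \<eta> x \<partial>orbit P z) \<le> (\<integral>x. indicator (mcball y (4 * \<eta>)) x \<partial>orbit P z)"
      using bump_le_indicator[OF \<open>0 < \<eta>\<close>] bounded_continuous_integrable[OF Metric_space_d bump_bounded_continuous inv]
      by (intro integral_mono integrable_real_indicator)
        (auto simp: orb.emeasure_eq_measure mcball_in_borel_metric[OF Metric_space_d])
    also have "\<dots> = measure (orbit P z) (mcball y (4 * \<eta>))"
      by (simp add: space_borel_d)
    also have "\<dots> < \<eta> ^ n"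
      using card measure_orbit_measure[OF \<open>0 < P\<close> space_borel_d mcball_in_borel_metric[OF Metric_space_d]] by simp
    finally show ?thesis .
  qed
  then show ?thesis using inv Y assms(3,4) unfolding spread_def by blast
qed

section \<open>Density of the three conditions\<close>

lemma weak_dense:
  assumes W: "W \<subseteq> invariant_measures d full_shift"
    and ex: "\<And>F \<mu> \<epsilon>. finite F \<Longrightarrow> F \<subseteq> bounded_continuous d \<Longrightarrow> 0 < \<epsilon> \<Longrightarrow> \<mu> \<in> invariant_measures d full_shift \<Longrightarrow>
      \<exists>P>0. \<exists>z. orbit P z \<in> W \<and> (\<forall>f\<in>F. \<bar>birkhoff_avg full_shift P f z - (\<integral>x. f x \<partial>\<mu>)\<bar> < \<epsilon>)"
  shows "weak closure_of W = topspace weak"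
proof (rule antisym[OF closure_of_subset_topspace], rule subsetI)
  fix \<mu> assume \<mu>: "\<mu> \<in> topspace weak"
  show "\<mu> \<in> weak closure_of W"
    unfolding in_closure_of
  proof (intro conjI \<mu> allI impI)
    fix U assume U: "\<mu> \<in> U \<and> openin weak U"
    obtain F \<epsilon> where F: "finite F" "F \<subseteq> bounded_continuous d" "0 < \<epsilon>"
      "\<And>\<nu>. \<nu> \<in> invariant_measures d full_shift \<Longrightarrow>
        (\<And>f. f \<in> F \<Longrightarrow> \<bar>(\<integral>x. f x \<partial>\<nu>) - (\<integral>x. f x \<partial>\<mu>)\<bar> < \<epsilon>) \<Longrightarrow> \<nu> \<in> U"
      using weak_topology_basis[OF U[THEN conjunct2] U[THEN conjunct1]] by blast
    obtain P z where P: "0 < P" "orbit P z \<in> W"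
      "\<And>f. f \<in> F \<Longrightarrow> \<bar>birkhoff_avg full_shift P f z - (\<integral>x. f x \<partial>\<mu>)\<bar> < \<epsilon>"
      using ex[OF F(1-3), of \<mu>] \<mu> by auto
    have "orbit P z \<in> U"
    proof (rule F(4))
      show "orbit P z \<in> invariant_measures d full_shift" using P(2) W by blast
      fix f assume "f \<in> F"
      then show "\<bar>(\<integral>x. f x \<partial>orbit P z) - (\<integral>x. f x \<partial>\<mu>)\<bar> < \<epsilon>"
        using P(3) integral_orbit[OF P(1), of f z] F(2) by auto
    qed
    then show "\<exists>\<nu>. \<nu> \<in> W \<and> \<nu> \<in> U" using P(2) by blast
  qed
qed

lemma dense_concentrated: "weak closure_of (concentrated n) = topspace weak"
proof (rule weak_dense)
  show "concentrated n \<subseteq> invariant_measures d full_shift" by (auto simp: concentrated_def)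
  fix F \<mu> and \<epsilon> :: real
  assume "finite F" "F \<subseteq> bounded_continuous d" "0 < \<epsilon>" "\<mu> \<in> invariant_measures d full_shift"
  then show "\<exists>P>0. \<exists>z. orbit P z \<in> concentrated n \<and>
      (\<forall>f\<in>F. \<bar>birkhoff_avg full_shift P f z - (\<integral>x. f x \<partial>\<mu>)\<bar> < \<epsilon>)"
    using periodic_approximation[of \<mu> F \<epsilon>] orbit_concentrated by blast
qed

lemma dense_averaging:
  assumes "f \<in> bounded_continuous d"
  shows "weak closure_of (averaging f n) = topspace weak"
proof (rule weak_dense)
  show "averaging f n \<subseteq> invariant_measures d full_shift" by (auto simp: averaging_def)
  fix F \<mu> and \<epsilon> :: real
  assume "finite F" "F \<subseteq> bounded_continuous d" "0 < \<epsilon>" "\<mu> \<in> invariant_measures d full_shift"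
  then show "\<exists>P>0. \<exists>z. orbit P z \<in> averaging f n \<and>
      (\<forall>f\<in>F. \<bar>birkhoff_avg full_shift P f z - (\<integral>x. f x \<partial>\<mu>)\<bar> < \<epsilon>)"
    using periodic_approximation[of \<mu> F \<epsilon>] orbit_averaging[OF _ _ assms] by blast
qed

lemma dense_spread: "weak closure_of (spread n) = topspace weak"
proof (rule weak_dense)
  show "spread n \<subseteq> invariant_measures d full_shift" by (auto simp: spread_def)
  fix F \<mu> and \<epsilon> :: real
  assume F: "finite F" "F \<subseteq> bounded_continuous d" "0 < \<epsilon>" and \<mu>: "\<mu> \<in> invariant_measures d full_shift"
  have "0 < \<epsilon> / 2" using F(3) by simp
  obtain P z where P: "0 < P" "(full_shift ^^ P) z = z"
    "\<And>f. f \<in> F \<Longrightarrow> \<bar>birkhoff_avg full_shift P f z - (\<integral>x. f x \<partial>\<mu>)\<bar> < \<epsilon> / 2"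
    using periodic_approximation[OF \<mu> F(1,2) \<open>0 < \<epsilon> / 2\<close>] by blast
  obtain Q w \<eta> where Q: "0 < Q" "(full_shift ^^ Q) w = w"
    "\<And>f. f \<in> F \<Longrightarrow> \<bar>birkhoff_avg full_shift Q f w - birkhoff_avg full_shift P f z\<bar> < \<epsilon> / 2"
    "0 < \<eta>" "\<eta> \<le> 1 / real (Suc n)"
    "\<And>y. real (card {i. i < Q \<and> (full_shift ^^ i) w \<in> mcball y (4 * \<eta>)}) / real Q < \<eta> ^ n"
    using spread_periodic_point[OF P(2,1) F(1,2) \<open>0 < \<epsilon> / 2\<close>, of n] by blast
  have "\<bar>birkhoff_avg full_shift Q f w - (\<integral>x. f x \<partial>\<mu>)\<bar> < \<epsilon>" if "f \<in> F" for f
    using P(3)[OF that] Q(3)[OF that] by linarith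
  then show "\<exists>P>0. \<exists>z. orbit P z \<in> spread n \<and>
      (\<forall>f\<in>F. \<bar>birkhoff_avg full_shift P f z - (\<integral>x. f x \<partial>\<mu>)\<bar> < \<epsilon>)"
    using orbit_spread[OF Q(2,1,4,5,6)] Q(1) by blast
qed

section \<open>Properties of measures in the intersection\<close>

lemma concentrated_hausdorff_dim:
  assumes "\<And>n. \<mu> \<in> concentrated n"
  shows "upper_hausdorff_dim d \<mu> = 0"
proof -
  have inv: "\<mu> \<in> invariant_measures d full_shift" using assms[of 0] by (simp add: concentrated_def)
  then interpret prob_space \<mu> by (simp add: invariant_measures_def)
  have sets: "sets \<mu> = sets (borel_metric d)" using inv by (simp add: invariant_measures_def)
  show ?thesis
  proof (rule upper_hausdorff_dim_zero[OF Metric_space_d prob_space_axioms sets])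
    fix n :: nat
    obtain Y \<rho> where Y: "finite Y" "0 < \<rho>" "2 * \<rho> \<le> (1 / 2) ^ n"
      "real (card Y) * (2 * \<rho>) powr (1 / real (Suc n)) \<le> (1 / 2) ^ n"
      "1 - 1 / real (Suc n) < expectation (\<lambda>x. min 1 (\<Sum>y\<in>Y. bump y (\<rho> / 8) x))"
      using assms[of n] unfolding concentrated_def by blast
    let ?U = "\<Union>y\<in>Y. mball y \<rho>" and ?f = "\<lambda>x. min 1 (\<Sum>y\<in>Y. bump y (\<rho> / 8) x)"
    have U: "?U \<in> events" unfolding sets by (intro sets.finite_UN Y mball_in_borel_metric Metric_space_d)
    have [measurable]: "bump y (\<rho> / 8) \<in> borel_measurable \<mu>" for y
      by (rule bounded_continuous_measurable[OF Metric_space_d bump_bounded_continuous sets])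
    have f0: "0 \<le> ?f x" for x by (auto intro!: sum_nonneg simp: bump_def)
    have "expectation ?f \<le> expectation (indicator ?U)"
    proof (rule integral_mono)
      show "integrable \<mu> ?f" using f0 by (intro integrable_const_bound[where B=1]) auto
      show "integrable \<mu> (indicator ?U :: _ \<Rightarrow> real)"
        using U by (intro integrable_real_indicator) (auto simp: emeasure_eq_measure)
      fix x show "?f x \<le> indicator ?U x"
      proof (cases "x \<in> ?U")
        case False
        \<comment> \<open>At scale \<open>\<rho> / 8\<close> the bump vanishes from distance
          \<open>\<rho> / 2\<close> on, in particular off the ball of radius \<rho>.\<close>
        have "bump y (\<rho> / 8) x = 0" if "y \<in> Y" for y
        proof -
          have "\<rho> \<le> d y x" using False that by auto
          then show ?thesis using \<open>0 < \<rho>\<close> by (simp add: bump_def field_simps)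
        qed
        then show ?thesis by simp
      qed simp
    qed
    also have "\<dots> = prob ?U" using space_invariant_measure[OF inv] by simp
    finally show "\<exists>Y \<rho>. finite Y \<and> 0 < \<rho> \<and> 2 * \<rho> \<le> (1 / 2) ^ n \<and>
      real (card Y) * (2 * \<rho>) powr (1 / real (Suc n)) \<le> (1 / 2) ^ n \<and>
      1 - 1 / real (Suc n) \<le> prob (\<Union>y\<in>Y. mball y \<rho>)"
      using Y by (intro exI[of _ Y] exI[of _ \<rho>] conjI) linarith+
  qed
qed

lemma spread_packing_dim:
  assumes "\<And>n. \<mu> \<in> spread n"
  shows "lower_packing_dim d \<mu> = \<infinity>"
proof -
  have inv: "\<mu> \<in> invariant_measures d full_shift" using assms[of 0] by (simp add: spread_def)
  then interpret prob_space \<mu> by (simp add: invariant_measures_def)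
  have sets: "sets \<mu> = sets (borel_metric d)" using inv by (simp add: invariant_measures_def)
  show ?thesis
  proof (rule lower_packing_dim_infinite[OF Metric_space_d sets])
    fix n
    obtain Y \<epsilon> where Y: "\<And>x. \<exists>y\<in>Y. d y x < \<epsilon>" "0 < \<epsilon>" "\<epsilon> \<le> 1 / real (Suc n)"
      "\<And>y. y \<in> Y \<Longrightarrow> expectation (bump y \<epsilon>) < \<epsilon> ^ n"
      using assms[of n] unfolding spread_def by blast
    have "emeasure \<mu> (mcball x (2 * \<epsilon>)) \<le> ennreal (\<epsilon> ^ n)" for x
    proof -
      obtain y where y: "y \<in> Y" "d y x < \<epsilon>" using Y(1) by blast
      have ball: "mcball y (3 * \<epsilon>) \<in> events" unfolding sets by (rule mcball_in_borel_metric[OF Metric_space_d])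
      have "mcball x (2 * \<epsilon>) \<subseteq> mcball y (3 * \<epsilon>)"
      proof
        fix w assume "w \<in> mcball x (2 * \<epsilon>)"
        then show "w \<in> mcball y (3 * \<epsilon>)" using y(2) triangle[of y x w] by simp
      qed
      then have "prob (mcball x (2 * \<epsilon>)) \<le> prob (mcball y (3 * \<epsilon>))"
        using ball by (rule finite_measure_mono)
      also have "\<dots> = expectation (indicator (mcball y (3 * \<epsilon>)))"
        using space_invariant_measure[OF inv] by simp
      also have "\<dots> \<le> expectation (bump y \<epsilon>)"
        using indicator_le_bump[OF Y(2)] ball bounded_continuous_integrable[OF Metric_space_d bump_bounded_continuous inv]
        by (intro integral_mono integrable_real_indicator) (auto simp: emeasure_eq_measure)
      also have "\<dots> < \<epsilon> ^ n" by (rule Y(4)[OF y(1)])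
      finally show ?thesis by (simp add: emeasure_eq_measure ennreal_leI)
    qed
    then show "\<exists>\<epsilon>>0. \<epsilon> \<le> 1 / real (Suc n) \<and> (\<forall>x. emeasure \<mu> (mcball x (2 * \<epsilon>)) \<le> ennreal (\<epsilon> ^ n))"
      using Y(2,3) by blast
  qed
qed

lemma residual:
  "residual_in weak {\<mu> \<in> ergodic_measures d full_shift. upper_hausdorff_dim d \<mu> = 0 \<and> lower_packing_dim d \<mu> = \<infinity>}"
proof -
  have "\<exists>Y. finite Y \<and> (\<forall>x. \<exists>y\<in>Y. d y x < 1 / real (Suc n))" for n
    using finite_net[of "1 / real (Suc n)"] by (metis of_nat_0_less_iff zero_less_Suc zero_less_divide_1_iff)
  then obtain Y where Y: "\<And>n. finite (Y n)" "\<And>n x. \<exists>y\<in>Y n. d y x < 1 / real (Suc n)" by metis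
  define D where "D = (\<Union>n. Y n)"
  have "countable D" unfolding D_def using Y(1) by (intro countable_UN) (auto intro: countable_finite)
  have dense: "\<exists>y\<in>D. d y x < \<epsilon>" if "0 < \<epsilon>" for x \<epsilon>
  proof -
    obtain n where "1 / real (Suc n) < \<epsilon>" using \<open>0 < \<epsilon>\<close> nat_approx_posE by blast
    moreover obtain y where "y \<in> Y n" "d y x < 1 / real (Suc n)" using Y(2) by blast
    ultimately show ?thesis unfolding D_def by (meson UNIV_I UN_I less_trans)
  qed
  obtain \<C> \<P> where C: "countable \<C>" "\<C> \<subseteq> bounded_continuous d" and P: "Int_stable \<P>"
    "sets (borel_metric d) = sigma_sets UNIV \<P>"
    "\<And>P. P \<in> \<P> \<Longrightarrow> \<exists>f. \<forall>k::nat. f k \<in> \<C> \<and> (\<forall>x. \<bar>f k x\<bar> \<le> (1::real)) \<and> (\<forall>x. (\<lambda>k. f k x) \<longlonglongrightarrow> indicator P x)"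
    using countable_determining_family[OF Metric_space_d \<open>countable D\<close> dense] by metis
  \<comment> \<open>Countable, since \<open>f\<close> ranges only over the determining
    family.\<close>
  define \<G> where "\<G> = range concentrated \<union> range spread \<union> (\<Union>f\<in>\<C>. range (averaging f))"
  have "countable \<G>" unfolding \<G>_def using C(1) by auto
  moreover have "openin weak U \<and> weak closure_of U = topspace weak" if "U \<in> \<G>" for U
    using that C(2) openin_concentrated dense_concentrated openin_spread dense_spread openin_averaging dense_averaging
    unfolding \<G>_def by blast
  moreover have "\<mu> \<in> ergodic_measures d full_shift \<and> upper_hausdorff_dim d \<mu> = 0 \<and> lower_packing_dim d \<mu> = \<infinity>"
    if \<mu>: "\<mu> \<in> topspace weak" "\<mu> \<in> \<Inter>\<G>" for \<mu>
  proof (intro conjI)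
    have inv: "\<mu> \<in> invariant_measures d full_shift" using \<mu>(1) by simp
    then have sets: "sets \<mu> = sets (borel_metric d)" by (simp add: invariant_measures_def)
    have in_G: "U \<in> \<G> \<Longrightarrow> \<mu> \<in> U" for U using \<mu>(2) by blast
    have conc: "\<mu> \<in> concentrated n" for n by (rule in_G) (simp add: \<G>_def)
    have spr: "\<mu> \<in> spread n" for n by (rule in_G) (simp add: \<G>_def)
    have avg: "\<mu> \<in> averaging f n" if "f \<in> \<C>" for f n
    proof -
      have "averaging f n \<in> range (averaging f)" by (rule rangeI)
      then have "averaging f n \<in> \<G>" using that unfolding \<G>_def by (intro UnI2 UN_I)
      then show ?thesis by (rule in_G)
    qed
    show "upper_hausdorff_dim d \<mu> = 0" by (rule concentrated_hausdorff_dim) (rule conc)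
    show "lower_packing_dim d \<mu> = \<infinity>" by (rule spread_packing_dim) (rule spr)
    show "\<mu> \<in> ergodic_measures d full_shift"
    proof (rule ergodicI[OF inv measurable_shift[OF sets] P(1) _ P(3)])
      show "sets \<mu> = sigma_sets UNIV \<P>" using sets P(2) by simp
      show "f \<in> borel_measurable \<mu>" if "f \<in> \<C>" for f
        using that C(2) by (intro bounded_continuous_measurable[OF Metric_space_d _ sets]) auto
      fix f and e :: real assume f: "f \<in> \<C>" and "0 < e"
      obtain n where "1 / real (Suc n) < e" using \<open>0 < e\<close> nat_approx_posE by blast
      then show "\<exists>N>0. (\<integral>x. (birkhoff_avg full_shift N f x)\<^sup>2 \<partial>\<mu>) - (\<integral>x. f x \<partial>\<mu>)\<^sup>2 < e"
        using avg[OF f, of n] unfolding averaging_def by (auto intro: less_trans)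
    qed
  qed
  ultimately show ?thesis
    unfolding residual_in_def by (intro conjI exI[of _ \<G>]) (auto simp: ergodic_measures_def)
qed

end

theorem corollary1p3:
  fixes a :: "nat \<Rightarrow> real"
  assumes "compact (UNIV :: 'a::{metric_space, perfect_space} set)"
    and "mono a"
    and "\<And>n. 0 \<le> a n"
    and "summable (\<lambda>k. 1 / (a k + 1))"
    and "\<And>\<alpha>::real. \<alpha> > 0 \<Longrightarrow> (\<lambda>k. a k / exp (\<alpha> * real k)) \<longlonglongrightarrow> 0"
  shows "residual_in
           (weak_topology (shift_dist a) (full_shift :: (int \<Rightarrow> 'a) \<Rightarrow> (int \<Rightarrow> 'a)))
           {\<mu> \<in> ergodic_measures (shift_dist a) full_shift.
              upper_hausdorff_dim (shift_dist a) \<mu> = 0 \<and>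
              lower_packing_dim (shift_dist a) \<mu> = \<infinity>}"
proof -
  interpret compact_full_shift a "shift_dist a :: (int \<Rightarrow> 'a) \<Rightarrow> _"
    by unfold_locales (use assms in auto)
  show ?thesis by (rule residual)
qed

end
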